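(* For every interdependent-values instance with $m$ goods, $n$ buyer types and $\ell$ seller types, there exists an independent-values instance with $m\cdot\ell$ goods, $n$ buyer types and $\ell$ seller types that is equivalent to it in the following sense: for all $M$ and $R$, the $(M,R)$-cheap talk games of the two instances admit the same equilibrium utilities (that is, the same expected utilities of the buyer and the seller are attained in equilibria of the one game as in equilibria of the other).
   Context: **Independent-values instance.** There are a seller, a buyer and $m$ goods. There are $n$ buyer types $i\in[n]=\{1,\dots,n\}$ with value vectors $v^i\in\mathbb{R}_{\ge 0}^m$ and $\ell$ seller types $k\in[\ell]$ with cost vectors $c^k\in\mathbb{R}_{\ge 0}^m$. The buyer's type and the seller's type are drawn independently from commonly known distributions. **The $(M,R)$-cheap talk game of an independent-values instance** ($M\ge1$, $R\ge 0$ integers): 1. The buyer privately observes his type $i$ (equivalently $v^i$). 2. The seller privately observes her type $k$ and cost vector $c^k$. 3. There are $R$ rounds of cheap talk, indexed backwards: $r=R,R-1,\dots,1$. In round $r$, if $r$ is even the seller publicly chooses a message in $[M]$; if $r$ is odd the buyer publicly chooses a message in $[M]$. 4. The seller posts a menu $((x^1,p^1),\dots,(x^n,p^n))$ with each $x^{i'}\in[0,1]^m$ and $p^{i'}\in\mathbb{R}_{\ge 0}\cup\{\infty\}$ (price $\infty$ represents an option that is not offered). 5. The buyer chooses an option $i'\in\{0,1,\dots,n\}$. If $i'=0$ both payoffs are $0$. Otherwise the buyer's payoff is $-p^{i'}+\sum_{j=1}^m x^{i'}_j v^i_j$ and the seller's payoff is $p^{i'}-\sum_{j=1}^m x^{i'}_j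 c^k_j$. **Interdependent-values instance.** There are a seller, a buyer and $m$ goods, with $n$ buyer types $i\in[n]$ and $\ell$ seller types $k\in[\ell]$. The buyer's type and the seller's type are drawn independently from commonly known distributions. A seller of type $k$ has cost vector $c^k\in\mathbb{R}_{\ge 0}^m$. The buyer's value for good $j$ depends on both types: it is $v^{i,k}_j\in\mathbb{R}_{\ge 0}$ when the buyer has type $i$ and the seller has type $k$. **The $(M,R)$-cheap talk game of an interdependent-values instance** ($M\ge1$, $R\ge 0$ integers): 1. The buyer privately observes only his own type $i$. 2. The seller privately observes her type $k$ and cost vector $c^k$. 3. There are $R$ rounds of cheap talk, indexed backwards: $r=R,R-1,\dots,1$. In round $r$, if $r$ is even the seller publicly chooses a message in $[M]$; if $r$ is odd the buyer publicly chooses a message in $[M]$. 4. The seller posts a menu $((x^1,p^1),\dots,(x^n,p^n))$ with each $x^{i'}\in[0,1]^m$ and $p^{i'}\in\mathbb{R}_{\ge 0}\cup\{\infty\}$ (price $\infty$ represents an option that is not offered). When the menu is posted, the buyer learns the seller's true type $k$ (hence before choosing an option). 5. The buyer chooses an option $i'\in\{0,1,\dots,n\}$. If $i'=0$ both payoffs are $0$. Otherwise the buyer's payoff is $-p^{i'}+\sum_{j=1}^m x^{i'}_j v^{i,k}_j$ and the seller's payoff is $p^{i'}-\sum_{j=1}^m x^{i'}_j c^k_j$. **Equilibrium.** Equilibrium means subgame-perfect Bayes-Nash equilibrium: type-dependent strategies together with, after each history, beliefs about the other player's type, such that after every history no type has a profitable deviation in the continuation given the beliefs and the other player's strategy, and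 beliefs are derived from the prior by Bayes' rule whenever it applies. *)

theory Defs
  imports "HOL-Probability.Probability"
begin

text \<open>
  The finite types \<open>'n\<close>, \<open>'l\<close>, \<open>'g\<close> are the sets of buyer types, seller types and goods.
  A menu has one entry (allocation, price) per buyer type; a price in \<open>ennreal\<close> is an element
  of the nonnegative reals together with infinity.
\<close>

type_synonym ('n, 'g) menu = "'n \<Rightarrow> ('g \<Rightarrow> real) \<times> ennreal"

definition menu_space :: "('n, 'g) menu measure" where
  "menu_space = restrict_space borel {\<mu>. \<forall>i j. fst (\<mu> i) j \<in> {0..1}}"

text \<open>
  The choice \<open>None\<close> is the outside option \<open>0\<close>. An entry with infinite price is not offered, so
  it cannot be chosen; on the choices that can be made, all payoffs are real numbers.
\<close>

definition offered :: "('n, 'g) menu \<Rightarrow> 'n option set" where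
  "offered \<mu> = insert None (Some ` {i. snd (\<mu> i) \<noteq> \<infinity>})"

definition buyer_payoff :: "('g::finite \<Rightarrow> real) \<Rightarrow> ('n, 'g) menu \<Rightarrow> 'n option \<Rightarrow> real" where
  "buyer_payoff v \<mu> a = (case a of None \<Rightarrow> 0
     | Some i \<Rightarrow> - enn2real (snd (\<mu> i)) + (\<Sum>j\<in>UNIV. fst (\<mu> i) j * v j))"

definition seller_payoff :: "('g::finite \<Rightarrow> real) \<Rightarrow> ('n, 'g) menu \<Rightarrow> 'n option \<Rightarrow> real" where
  "seller_payoff c \<mu> a = (case a of None \<Rightarrow> 0
     | Some i \<Rightarrow> enn2real (snd (\<mu> i)) - (\<Sum>j\<in>UNIV. fst (\<mu> i) j * c j))"


record ('n, 'l, 'g) trade_data =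
  buyer_prior :: "'n pmf"
  seller_prior :: "'l pmf"
  cost :: "'l \<Rightarrow> 'g \<Rightarrow> real"

record ('n, 'l, 'g) indep_data = "('n, 'l, 'g) trade_data" +
  indep_val :: "'n \<Rightarrow> 'g \<Rightarrow> real"

record ('n, 'l, 'g) interdep_data = "('n, 'l, 'g) trade_data" +
  interdep_val :: "'n \<Rightarrow> 'l \<Rightarrow> 'g \<Rightarrow> real"

definition indep_values_instance :: "('n, 'l, 'g) indep_data \<Rightarrow> bool" where
  "indep_values_instance I \<longleftrightarrow>
     (\<forall>k j. 0 \<le> cost I k j) \<and> (\<forall>i j. 0 \<le> indep_val I i j)"

definition interdep_values_instance :: "('n, 'l, 'g) interdep_data \<Rightarrow> bool" where
  "interdep_values_instance I \<longleftrightarrow>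
     (\<forall>k j. 0 \<le> cost I k j) \<and> (\<forall>i k j. 0 \<le> interdep_val I i k j)"

text \<open>
  Both cheap talk games are cases of one form of game: \<open>buyer_val G i k\<close> is the value vector of
  buyer type \<open>i\<close> against seller type \<open>k\<close>, and \<open>signal G k\<close> is what the buyer observes,
  besides the menu itself, when a seller of type \<open>k\<close> posts a menu: nothing under
  independent values, the type \<open>k\<close> under interdependent values.
\<close>

record ('n, 'l, 'g, 's) talk_game = "('n, 'l, 'g) trade_data" +
  buyer_val :: "'n \<Rightarrow> 'l \<Rightarrow> 'g \<Rightarrow> real"
  signal :: "'l \<Rightarrow> 's"

definition indep_game :: "('n, 'l, 'g) indep_data \<Rightarrow> ('n, 'l, 'g, unit) talk_game" where
  "indep_game I = \<lparr>buyer_prior = buyer_prior I, seller_prior = seller_prior I, cost = cost I,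
     buyer_val = (\<lambda>i k. indep_val I i), signal = (\<lambda>k. ())\<rparr>"

definition interdep_game :: "('n, 'l, 'g) interdep_data \<Rightarrow> ('n, 'l, 'g, 'l) talk_game" where
  "interdep_game I = \<lparr>buyer_prior = buyer_prior I, seller_prior = seller_prior I, cost = cost I,
     buyer_val = interdep_val I, signal = (\<lambda>k. k)\<rparr>"


text \<open>
  A history of the talk phase is the list of the messages sent so far, the oldest first. After
  \<open>h\<close> the current round is \<open>r = R - length h\<close>; the menu is posted when \<open>length h = R\<close>.
\<close>

definition histories :: "nat \<Rightarrow> nat \<Rightarrow> nat list set" where
  "histories M R = {h. set h \<subseteq> {1..M} \<and> length h \<le> R}"

text \<open>
  Behaviour strategies. The seller may randomise over menus by an arbitrary Borel probability
  measure; correspondingly the buyer's choice has to depend measurably on the menu.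
\<close>

record ('n, 'l, 'g) seller_strategy =
  seller_msg :: "nat list \<Rightarrow> 'l \<Rightarrow> nat pmf"
  seller_menu :: "nat list \<Rightarrow> 'l \<Rightarrow> ('n, 'g) menu measure"

record ('n, 'g, 's) buyer_strategy =
  buyer_msg :: "nat list \<Rightarrow> 'n \<Rightarrow> nat pmf"
  buyer_choice :: "nat list \<Rightarrow> 's \<Rightarrow> ('n, 'g) menu \<Rightarrow> 'n \<Rightarrow> 'n option pmf"

definition valid_seller_strategy ::
  "nat \<Rightarrow> nat \<Rightarrow> ('n, 'l, 'g) seller_strategy \<Rightarrow> bool" where
  "valid_seller_strategy M R s \<longleftrightarrow> (\<forall>h\<in>histories M R. \<forall>k.
     set_pmf (seller_msg s h k) \<subseteq> {1..M} \<and>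
     seller_menu s h k \<in> space (prob_algebra menu_space))"

definition valid_buyer_strategy ::
  "nat \<Rightarrow> nat \<Rightarrow> ('n, 'g, 's) buyer_strategy \<Rightarrow> bool" where
  "valid_buyer_strategy M R b \<longleftrightarrow> (\<forall>h\<in>histories M R. \<forall>i.
     set_pmf (buyer_msg b h i) \<subseteq> {1..M} \<and>
     (\<forall>t. (\<forall>\<mu>\<in>space menu_space. set_pmf (buyer_choice b h t \<mu> i) \<subseteq> offered \<mu>) \<and>
          (\<forall>a. (\<lambda>\<mu>. pmf (buyer_choice b h t \<mu> i) a) \<in> borel_measurable menu_space)))"

text \<open>
  \<open>expected_payoff G M b s i k f r h\<close> is the expectation of the payoff function \<open>f\<close> of
  (menu, choice) when types \<open>i\<close> and \<open>k\<close> play on from history \<open>h\<close> with \<open>r\<close> rounds left.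

  The integral is the Bochner integral, which is \<open>0\<close> for a nonintegrable integrand. This is
  immaterial in the equilibrium definition below. If the choices of the buyer are optimal
  after every menu, the payoffs resulting from a menu are bounded, uniformly in the menu. The
  only other case is a buyer deviation. There the integrand is bounded above, so the correct value
  for a nonintegrable one would be minus infinity; and also with the value \<open>0\<close> such a deviation
  does no better than optimal choices, whose expected payoff is at least \<open>0\<close>.
\<close>

primrec expected_payoff ::
  "('n::finite, 'l, 'g, 's) talk_game \<Rightarrow> nat \<Rightarrow>
   ('n, 'g, 's) buyer_strategy \<Rightarrow> ('n, 'l, 'g) seller_strategy \<Rightarrow> 'n \<Rightarrow> 'l \<Rightarrow>
   (('n, 'g) menu \<Rightarrow> 'n option \<Rightarrow> real) \<Rightarrow> nat \<Rightarrow> nat list \<Rightarrow> real" where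
  "expected_payoff G M b s i k f 0 h =
     (\<integral>\<mu>. (\<Sum>a\<in>UNIV. pmf (buyer_choice b h (signal G k) \<mu> i) a * f \<mu> a) \<partial>seller_menu s h k)"
| "expected_payoff G M b s i k f (Suc r) h =
     (\<Sum>x\<in>{1..M}. pmf (if even (Suc r) then seller_msg s h k else buyer_msg b h i) x *
        expected_payoff G M b s i k f r (h @ [x]))"

definition buyer_utility ::
  "('n::finite, 'l::finite, 'g::finite, 's) talk_game \<Rightarrow> nat \<Rightarrow> nat \<Rightarrow>
   ('n, 'g, 's) buyer_strategy \<Rightarrow> ('n, 'l, 'g) seller_strategy \<Rightarrow> 'l pmf \<Rightarrow>
   'n \<Rightarrow> nat list \<Rightarrow> real" where
  "buyer_utility G M R b s \<beta> i h =
     (\<Sum>k\<in>UNIV. pmf \<beta> k *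
        expected_payoff G M b s i k (buyer_payoff (buyer_val G i k)) (R - length h) h)"

definition seller_utility ::
  "('n::finite, 'l::finite, 'g::finite, 's) talk_game \<Rightarrow> nat \<Rightarrow> nat \<Rightarrow>
   ('n, 'g, 's) buyer_strategy \<Rightarrow> ('n, 'l, 'g) seller_strategy \<Rightarrow> 'n pmf \<Rightarrow>
   'l \<Rightarrow> nat list \<Rightarrow> real" where
  "seller_utility G M R b s \<beta> k h =
     (\<Sum>i\<in>UNIV. pmf \<beta> i *
        expected_payoff G M b s i k (seller_payoff (cost G k)) (R - length h) h)"

text \<open>
  Beliefs: \<open>\<beta>B h\<close> is the seller's belief about the buyer's type and \<open>\<beta>S h\<close> the buyer's belief
  about the seller's type after \<open>h\<close>. Types being independent, beliefs depend only on the public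
  history, and a message carries no information about the type of the receiver. Bayes' rule
  applies to a message (also after a history of probability zero) if the current belief
  about the sender gives that message positive probability.
\<close>

definition bayes_update :: "'t::finite pmf \<Rightarrow> ('t \<Rightarrow> nat pmf) \<Rightarrow> nat \<Rightarrow> 't pmf \<Rightarrow> bool" where
  "bayes_update \<beta> msg x \<beta>' \<longleftrightarrow>
     ((\<Sum>t\<in>UNIV. pmf \<beta> t * pmf (msg t) x) > 0 \<longrightarrow>
      (\<forall>t. pmf \<beta>' t = pmf \<beta> t * pmf (msg t) x / (\<Sum>t'\<in>UNIV. pmf \<beta> t' * pmf (msg t') x)))"

definition consistent_beliefs ::
  "('n::finite, 'l::finite, 'g, 's) talk_game \<Rightarrow> nat \<Rightarrow> nat \<Rightarrow>
   ('n, 'g, 's) buyer_strategy \<Rightarrow> ('n, 'l, 'g) seller_strategy \<Rightarrow>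
   (nat list \<Rightarrow> 'n pmf) \<Rightarrow> (nat list \<Rightarrow> 'l pmf) \<Rightarrow> bool" where
  "consistent_beliefs G M R b s \<beta>B \<beta>S \<longleftrightarrow>
     \<beta>B [] = buyer_prior G \<and> \<beta>S [] = seller_prior G \<and>
     (\<forall>h\<in>histories M R. \<forall>x\<in>{1..M}. length h < R \<longrightarrow>
        (if even (R - length h)
         then bayes_update (\<beta>S h) (seller_msg s h) x (\<beta>S (h @ [x])) \<and> \<beta>B (h @ [x]) = \<beta>B h
         else bayes_update (\<beta>B h) (buyer_msg b h) x (\<beta>B (h @ [x])) \<and> \<beta>S (h @ [x]) = \<beta>S h))"

text \<open>
  In both games \<open>buyer_val G i k\<close> is determined by \<open>i\<close> and \<open>signal G k\<close>. So when the buyer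
  chooses from a posted menu he knows his payoffs, and his belief about the seller's type after
  the menu plays no role.
\<close>

definition optimal_choices ::
  "('n::finite, 'l, 'g::finite, 's) talk_game \<Rightarrow> nat \<Rightarrow> nat \<Rightarrow> ('n, 'g, 's) buyer_strategy \<Rightarrow> bool"
  where
  "optimal_choices G M R b \<longleftrightarrow>
     (\<forall>h\<in>histories M R. length h = R \<longrightarrow> (\<forall>\<mu>\<in>space menu_space. \<forall>i k. \<forall>a\<in>offered \<mu>.
        buyer_payoff (buyer_val G i k) \<mu> a \<le>
        (\<Sum>a'\<in>UNIV. pmf (buyer_choice b h (signal G k) \<mu> i) a' *
           buyer_payoff (buyer_val G i k) \<mu> a')))"

definition equilibrium ::
  "('n::finite, 'l::finite, 'g::finite, 's) talk_game \<Rightarrow> nat \<Rightarrow> nat \<Rightarrow>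
   ('n, 'g, 's) buyer_strategy \<Rightarrow> ('n, 'l, 'g) seller_strategy \<Rightarrow>
   (nat list \<Rightarrow> 'n pmf) \<Rightarrow> (nat list \<Rightarrow> 'l pmf) \<Rightarrow> bool" where
  "equilibrium G M R b s \<beta>B \<beta>S \<longleftrightarrow>
     valid_buyer_strategy M R b \<and> valid_seller_strategy M R s \<and>
     consistent_beliefs G M R b s \<beta>B \<beta>S \<and>
     optimal_choices G M R b \<and>
     (\<forall>h\<in>histories M R. \<forall>i b'. valid_buyer_strategy M R b' \<longrightarrow>
        buyer_utility G M R b' s (\<beta>S h) i h \<le> buyer_utility G M R b s (\<beta>S h) i h) \<and>
     (\<forall>h\<in>histories M R. \<forall>k s'. valid_seller_strategy M R s' \<longrightarrow>
        seller_utility G M R b s' (\<beta>B h) k h \<le> seller_utility G M R b s (\<beta>B h) k h)"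

text \<open>Pairs of ex ante expected utilities (buyer, seller) attained in equilibrium.\<close>

definition equilibrium_utilities ::
  "('n::finite, 'l::finite, 'g::finite, 's) talk_game \<Rightarrow> nat \<Rightarrow> nat \<Rightarrow> (real \<times> real) set" where
  "equilibrium_utilities G M R =
     {(\<Sum>i\<in>UNIV. pmf (buyer_prior G) i * buyer_utility G M R b s (seller_prior G) i [],
       \<Sum>k\<in>UNIV. pmf (seller_prior G) k * seller_utility G M R b s (buyer_prior G) k [])
      | b s \<beta>B \<beta>S. equilibrium G M R b s \<beta>B \<beta>S}"

end

theory Submission
  imports Defs
begin

text \<open>
  The instance \<open>J\<close> has one copy \<open>(j, k')\<close> of good \<open>j\<close> for each seller type \<open>k'\<close>. Buyer type \<open>i\<close> values
  it at his value for good \<open>j\<close> against seller \<open>k'\<close>. It costs seller \<open>k'\<close> what good \<open>j\<close> costs her, and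
  it costs all other seller types a large amount \<open>H\<close>.

  A seller might offer foreign copies in order to screen the buyer types, possibly for a type that
  she considers very unlikely. This never pays if \<open>H\<close> is large enough, uniformly in her belief: the
  incentive-compatible and individually rational profiles of entries form a polytope that depends
  neither on \<open>H\<close> nor on the belief. At each of its finitely many vertices the positive quantities of
  foreign copies are bounded away from zero, so that for large \<open>H\<close> dropping the types that receive
  them raises the profit from these types. Convexity carries the improvement over to all profiles.

  By giving up a small share of her profit the seller makes the buyer break ties in her favour. So in
  every equilibrium her payoff from the menu stage is the supremum of the profits under favourable
  tie-breaking, which is the same number in both games. Beliefs being consistent, a strategy profile
  is an equilibrium iff no single message is a profitable deviation when the menu stage is replaced
  by its payoffs. Equilibria are carried to \<open>J\<close> by embedding menus, and back by withdrawing entries with foreign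
  copies; this hurts only buyer types that the seller's belief excludes, and such types
  can re-optimise their messages without any effect on beliefs.
\<close>

section \<open>Incentive-compatible profiles\<close>

text \<open>Vectors instead of functions make profiles a Euclidean space, in which polyhedra and
  polytopes are available. Prices are real: a buyer type that buys nothing is represented by the
  entry \<open>0\<close>, so infinite prices do not occur.\<close>

type_synonym ('n, 'h) profile = "((real ^ 'h) \<times> real) ^ 'n"

definition entry_utility :: "('h::finite \<Rightarrow> real) \<Rightarrow> (real ^ 'h) \<times> real \<Rightarrow> real" where
  "entry_utility v e = (\<Sum>j\<in>UNIV. v j * fst e $ j) - snd e"

definition entry_profit :: "('h::finite \<Rightarrow> real) \<Rightarrow> (real ^ 'h) \<times> real \<Rightarrow> real" where
  "entry_profit c e = snd e - (\<Sum>j\<in>UNIV. c j * fst e $ j)"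

text \<open>A profile lists the entry that each type ends up with, not a menu. The outside option
  enters as the requirement that utilities be nonnegative.\<close>

definition ic_profiles :: "('n::finite \<Rightarrow> 'h::finite \<Rightarrow> real) \<Rightarrow> ('n, 'h) profile set" where
  "ic_profiles v = {q. \<forall>i. (\<forall>j. 0 \<le> fst (q $ i) $ j \<and> fst (q $ i) $ j \<le> 1) \<and> 0 \<le> snd (q $ i) \<and>
     0 \<le> entry_utility (v i) (q $ i) \<and>
     (\<forall>i'. entry_utility (v i) (q $ i') \<le> entry_utility (v i) (q $ i))}"

lemma linear_entry_utility [simp]: "linear (entry_utility v)"
  by (rule linearI) (simp_all add: entry_utility_def algebra_simps sum.distrib sum_distrib_left)

lemma linear_entry_profit [simp]: "linear (entry_profit c)"
  by (rule linearI) (simp_all add: entry_profit_def algebra_simps sum.distrib sum_distrib_left)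

text \<open>A linear functional is the inner product with the fixed vector
  \<open>adjoint f 1\<close>, which brings the inequality into the form of a halfspace.\<close>

lemma polyhedron_linear_le:
  fixes f :: "'a::euclidean_space \<Rightarrow> real"
  assumes "linear f"
  shows "polyhedron {x. f x \<le> b}"
proof -
  have "f x = adjoint f 1 \<bullet> x" for x
    using adjoint_works[OF assms, of x 1] by (simp add: inner_commute)
  then show ?thesis
    using polyhedron_halfspace_le[of "adjoint f 1" b] by simp
qed

lemma polyhedron_Collect_conj:
  "polyhedron {x. P x} \<Longrightarrow> polyhedron {x. Q x} \<Longrightarrow> polyhedron {x. P x \<and> Q x}"
  by (simp add: Collect_conj_eq)

lemma polyhedron_Collect_all:
  fixes P :: "'i::finite \<Rightarrow> 'a::euclidean_space \<Rightarrow> bool"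
  assumes "\<And>i. polyhedron {x. P i x}"
  shows "polyhedron {x. \<forall>i. P i x}"
proof -
  have "{x. \<forall>i. P i x} = \<Inter>(range (\<lambda>i. {x. P i x}))"
    by auto
  then show ?thesis
    using assms by (auto intro!: polyhedron_Inter)
qed

text \<open>The definition is a finite conjunction of weak inequalities between linear functions of
  the profile.\<close>

lemma polyhedron_ic_profiles:
  fixes v :: "'n::finite \<Rightarrow> 'h::finite \<Rightarrow> real"
  shows "polyhedron (ic_profiles v)"
proof -
  have lin: "linear (\<lambda>q::('n, 'h) profile. f (q $ i))" if "linear f"
    for f :: "(real ^ 'h) \<times> real \<Rightarrow> real" and i
    using linear_compose[of "\<lambda>q. q $ i" f] that by (simp add: o_def bounded_linear.linear[OF bounded_linear_vec_nth])
  note lin_util = lin[OF linear_entry_utility]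
  have lin_fst: "linear (\<lambda>q::('n, 'h) profile. fst (q $ i) $ j)" for i j
    by (rule lin, rule linearI) simp_all
  have lin_snd: "linear (\<lambda>q::('n, 'h) profile. snd (q $ i))" for i
    by (rule lin, rule linear_snd)
  have ge: "polyhedron {x. 0 \<le> f x}" if "linear f" for f :: "('n, 'h) profile \<Rightarrow> real"
    using polyhedron_linear_le[of "\<lambda>x. - f x" 0] that by (simp add: linear_compose_neg)
  have le: "polyhedron {x. f x \<le> g x}" if "linear f" "linear g"
    for f g :: "('n, 'h) profile \<Rightarrow> real"
    using polyhedron_linear_le[of "\<lambda>x. f x - g x" 0] that by (simp add: linear_compose_sub)
  show ?thesis
    unfolding ic_profiles_def
    apply (rule polyhedron_Collect_all polyhedron_Collect_conj)+
      apply (rule ge[OF lin_fst])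
     apply (rule polyhedron_linear_le[OF lin_fst])
    apply (rule polyhedron_Collect_conj)
     apply (rule ge[OF lin_snd])
    apply (rule polyhedron_Collect_conj)
     apply (rule ge[OF lin_util])
    apply (rule polyhedron_Collect_all)
    apply (rule le[OF lin_util lin_util])
    done
qed

text \<open>Individual rationality bounds a price by the value of the full bundle. Summing over all
  types makes the bound uniform in \<open>i\<close>.\<close>

lemma ic_profiles_price_le:
  fixes v :: "'n::finite \<Rightarrow> 'h::finite \<Rightarrow> real"
  assumes v: "\<And>i j. 0 \<le> v i j" and q: "q \<in> ic_profiles v"
  shows "snd (q $ i) \<le> (\<Sum>i\<in>UNIV. \<Sum>j\<in>UNIV. v i j)"
proof -
  have "snd (q $ i) \<le> (\<Sum>j\<in>UNIV. v i j * fst (q $ i) $ j)"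
    using q by (simp add: ic_profiles_def entry_utility_def)
  also have "\<dots> \<le> (\<Sum>j\<in>UNIV. v i j)"
    using q v by (intro sum_mono mult_left_le) (auto simp: ic_profiles_def)
  also have "\<dots> \<le> (\<Sum>i\<in>UNIV. \<Sum>j\<in>UNIV. v i j)"
    using v by (intro member_le_sum[of i UNIV "\<lambda>i. \<Sum>j\<in>UNIV. v i j"] sum_nonneg) auto
  finally show ?thesis .
qed

lemma bounded_ic_profiles:
  fixes v :: "'n::finite \<Rightarrow> 'h::finite \<Rightarrow> real"
  assumes v: "\<And>i j. 0 \<le> v i j"
  shows "bounded (ic_profiles v)"
proof -
  define B where "B = (\<Sum>i\<in>UNIV. \<Sum>j\<in>UNIV. v i j)"
  have "norm q \<le> of_nat CARD('n) * (of_nat CARD('h) + B)" if q: "q \<in> ic_profiles v" for q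
  proof -
    have "norm (q $ i) \<le> of_nat CARD('h) + B" for i
    proof -
      have "norm (q $ i) \<le> norm (fst (q $ i)) + norm (snd (q $ i))"
        using norm_Pair_le[of "fst (q $ i)" "snd (q $ i)"] by simp
      also have "norm (snd (q $ i)) \<le> B"
        using ic_profiles_price_le[OF v q, of i] q by (simp add: B_def ic_profiles_def)
      also have "norm (fst (q $ i)) \<le> (\<Sum>j\<in>UNIV. \<bar>fst (q $ i) $ j\<bar>)"
        by (rule norm_le_l1_cart)
      also have "\<dots> \<le> (\<Sum>j\<in>(UNIV::'h set). 1)"
        using q by (intro sum_mono) (auto simp: ic_profiles_def)
      finally show ?thesis by simp
    qed
    then have "(\<Sum>i\<in>UNIV. norm (q $ i)) \<le> (\<Sum>i\<in>(UNIV::'n set). of_nat CARD('h) + B)"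
      by (intro sum_mono) 
    moreover have "norm q \<le> (\<Sum>i\<in>UNIV. norm (q $ i))"
      unfolding norm_vec_def by (rule L2_set_le_sum) simp
    ultimately show ?thesis by simp
  qed
  then show ?thesis
    unfolding bounded_iff by blast
qed

text \<open>A bounded polyhedron is a polytope. The elements of the finite generating set
  \<open>V\<close> serve as the vertices in what follows.\<close>

lemma vertices_ic_profiles:
  fixes v :: "'n::finite \<Rightarrow> 'h::finite \<Rightarrow> real"
  assumes "\<And>i j. 0 \<le> v i j"
  obtains V where "finite V" "ic_profiles v = convex hull V"
proof -
  have "polytope (ic_profiles v)"
    using polyhedron_ic_profiles[of v] bounded_ic_profiles[OF assms]
    by (simp add: polytope_eq_bounded_polyhedron)
  then show ?thesis
    using that by (auto simp: polytope_def)
qed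

text \<open>The comparison is made type by type, so that it implies a comparison of expected profits
  under every belief about the buyer.\<close>

definition improves_without ::
    "'h::finite set \<Rightarrow> ('h \<Rightarrow> real) \<Rightarrow> ('n::finite, 'h) profile \<Rightarrow> ('n, 'h) profile \<Rightarrow> bool" where
  "improves_without D c q' q \<longleftrightarrow> (\<forall>i. (\<forall>j\<in>D. fst (q' $ i) $ j = 0) \<and>
     entry_profit c (q $ i) \<le> entry_profit c (q' $ i) \<and>
     ((\<exists>j\<in>D. fst (q $ i) $ j \<noteq> 0) \<longrightarrow> entry_profit c (q $ i) < entry_profit c (q' $ i)))"

text \<open>Excluding the types that get goods from \<open>D\<close> relaxes the incentive constraints of all others,
  and the loss from it is bounded, whereas at a vertex the quantities of these goods are bounded
  away from zero.\<close>

lemma ic_profile_improvement_vertex: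
  fixes v :: "'n::finite \<Rightarrow> 'h::finite \<Rightarrow> real"
  assumes v: "\<And>i j. 0 \<le> v i j" and c: "\<And>j. 0 \<le> c j" and C: "(\<Sum>j\<in>-D. c j) \<le> C"
    and q: "q \<in> ic_profiles v"
    and eta: "\<And>i j. fst (q $ i) $ j \<noteq> 0 \<Longrightarrow> \<eta> \<le> fst (q $ i) $ j" "0 < \<eta>"
    and H: "\<And>j. j \<in> D \<Longrightarrow> ((\<Sum>i\<in>UNIV. \<Sum>j\<in>UNIV. v i j) + C + 1) / \<eta> \<le> c j"
  shows "\<exists>q'\<in>ic_profiles v. improves_without D c q' q"
proof -
  define B where "B = (\<Sum>i\<in>UNIV. \<Sum>j\<in>UNIV. v i j)"
  \<comment> \<open>\<open>A\<close> collects the types to be excluded. The others keep their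
    entries, and each excluded type picks its favourite among these entries and the outside option
    \<open>0\<close>.\<close>
  define A where "A = {i. \<exists>j\<in>D. fst (q $ i) $ j \<noteq> 0}"
  define S where "S = insert 0 ((\<lambda>i. q $ i) ` (-A))"
  define p where "p i = (SOME e. e \<in> S \<and> (\<forall>e'\<in>S. entry_utility (v i) e' \<le> entry_utility (v i) e))" for i
  have "\<exists>e. e \<in> S \<and> (\<forall>e'\<in>S. entry_utility (v i) e' \<le> entry_utility (v i) e)" for i
  proof -
    have "finite S" "S \<noteq> {}" by (auto simp: S_def)
    then have "Max (entry_utility (v i) ` S) \<in> entry_utility (v i) ` S"
      by (intro Max_in) auto
    then obtain e where "e \<in> S" "entry_utility (v i) e = Max (entry_utility (v i) ` S)"
      by fastforce
    then show ?thesis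
      using \<open>finite S\<close> by (intro exI[of _ e]) simp
  qed
  then have p: "p i \<in> S" "\<And>e'. e' \<in> S \<Longrightarrow> entry_utility (v i) e' \<le> entry_utility (v i) (p i)" for i
    using someI_ex[of "\<lambda>e. e \<in> S \<and> (\<forall>e'\<in>S. entry_utility (v i) e' \<le> entry_utility (v i) e)"]
    unfolding p_def by auto
  define q' :: "('n, 'h) profile" where "q' = (\<chi> i. if i \<in> A then p i else q $ i)"
  have q'_S: "q' $ i \<in> S" for i
    using p(1)[of i] by (auto simp: q'_def S_def)
  have S_box: "(\<forall>j. 0 \<le> fst e $ j \<and> fst e $ j \<le> 1) \<and> 0 \<le> snd e \<and> (\<forall>j\<in>D. fst e $ j = 0)" if "e \<in> S" for e
    using that q by (auto simp: S_def ic_profiles_def A_def)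
  have best: "entry_utility (v i) e \<le> entry_utility (v i) (q' $ i)" if "e \<in> S" for e i
  proof (cases "i \<in> A")
    case True
    then show ?thesis using p that by (simp add: q'_def)
  next
    case False
    \<comment> \<open>\<open>S\<close> contains only old entries and \<open>0\<close>, so a type
      outside \<open>A\<close> faces no new alternative.\<close>
    have "entry_utility (v i) e \<le> entry_utility (v i) (q $ i)"
      using that q by (auto simp: S_def ic_profiles_def linear_0)
    then show ?thesis using False by (simp add: q'_def)
  qed
  have "q' \<in> ic_profiles v"
    unfolding ic_profiles_def
    using S_box q'_S best best[of 0] by (auto simp: S_def linear_0)
  moreover have "improves_without D c q' q"
    unfolding improves_without_def
  proof (intro allI conjI)
    fix i
    show "\<forall>j\<in>D. fst (q' $ i) $ j = 0"
      using S_box q'_S by blast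
    have "entry_profit c (q $ i) < entry_profit c (q' $ i)" if i: "i \<in> A"
    proof -
      obtain j where j: "j \<in> D" "fst (q $ i) $ j \<noteq> 0"
        using i by (auto simp: A_def)
      have "0 \<le> B"
        using v by (auto simp: B_def intro!: sum_nonneg)
      have "0 \<le> C"
        using C sum_nonneg[of "-D" c] c by fastforce
      \<comment> \<open>An excluded type received at least \<eta> of some good in \<open>D\<close>.
        This alone costs \<open>B + C + 1\<close>, whereas the type pays at most \<open>B\<close>,
        so the profit was below \<open>- C\<close>. In \<open>q'\<close> prices are nonnegative and
        only goods outside \<open>D\<close> are delivered, at a cost of at most
        \<open>C\<close>.\<close>
      have "B + C + 1 = (B + C + 1) / \<eta> * \<eta>"
        using eta by simp
      also have "\<dots> \<le> c j * fst (q $ i) $ j"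
        using H[OF j(1)] eta j(2) \<open>0 \<le> B\<close> \<open>0 \<le> C\<close> c by (intro mult_mono) (auto simp: B_def)
      also have "\<dots> \<le> (\<Sum>j\<in>UNIV. c j * fst (q $ i) $ j)"
        using q c by (intro member_le_sum[of j UNIV "\<lambda>j. c j * fst (q $ i) $ j"])
          (auto simp: ic_profiles_def)
      finally have 1: "B + C + 1 \<le> (\<Sum>j\<in>UNIV. c j * fst (q $ i) $ j)" .
      have "snd (q $ i) \<le> B"
        using ic_profiles_price_le[OF v q] by (simp add: B_def)
      with 1 have "entry_profit c (q $ i) < - C"
        by (simp add: entry_profit_def)
      also have "- C \<le> entry_profit c (q' $ i)"
      proof -
        have "(\<Sum>j\<in>UNIV. c j * fst (q' $ i) $ j) = (\<Sum>j\<in>-D. c j * fst (q' $ i) $ j)"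
          using S_box[OF q'_S, of i] by (intro sum.mono_neutral_right) auto
        also have "\<dots> \<le> (\<Sum>j\<in>-D. c j)"
          using S_box[OF q'_S, of i] c by (intro sum_mono mult_left_le) auto
        finally show ?thesis
          using C S_box[OF q'_S, of i] by (simp add: entry_profit_def)
      qed
      finally show ?thesis .
    qed
    moreover have "q' $ i = q $ i" if "i \<notin> A"
      using that by (simp add: q'_def)
    ultimately show "entry_profit c (q $ i) \<le> entry_profit c (q' $ i)"
      "(\<exists>j\<in>D. fst (q $ i) $ j \<noteq> 0) \<longrightarrow> entry_profit c (q $ i) < entry_profit c (q' $ i)"
      by (fastforce simp: A_def)+
  qed
  ultimately show ?thesis by blast
qed

text \<open>Profit being linear, a mixture of improvements improves the mixture. A nonzero quantity
  in a mixture is nonzero in some component with positive weight, and the strict inequality of that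
  component survives. This takes the improvement from the vertices to their convex hull.\<close>

lemma convex_improvable:
  assumes "convex Q" and Q: "\<And>q i j. q \<in> Q \<Longrightarrow> 0 \<le> fst (q $ i) $ j"
  shows "convex {q \<in> Q. \<exists>q'\<in>Q. improves_without D c q' q}"
proof (rule convexI)
  fix q r a b
  assume *: "q \<in> {q \<in> Q. \<exists>q'\<in>Q. improves_without D c q' q}"
    "r \<in> {q \<in> Q. \<exists>q'\<in>Q. improves_without D c q' q}" and ab: "(0::real) \<le> a" "0 \<le> b" "a + b = 1"
  then obtain q' r' where qr: "q \<in> Q" "q' \<in> Q" "improves_without D c q' q"
    "r \<in> Q" "r' \<in> Q" "improves_without D c r' r"
    by blast
  have profit: "entry_profit c ((a *\<^sub>R q + b *\<^sub>R r) $ i)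
    = a * entry_profit c (q $ i) + b * entry_profit c (r $ i)" for q r i
    by (simp add: linear_add linear_scale)
  have "improves_without D c (a *\<^sub>R q' + b *\<^sub>R r') (a *\<^sub>R q + b *\<^sub>R r)"
    unfolding improves_without_def profit
  proof (intro allI conjI impI)
    fix i
    show "\<forall>j\<in>D. fst ((a *\<^sub>R q' + b *\<^sub>R r') $ i) $ j = 0"
      using qr by (simp add: improves_without_def)
    have le: "entry_profit c (q $ i) \<le> entry_profit c (q' $ i)"
      "entry_profit c (r $ i) \<le> entry_profit c (r' $ i)"
      using qr by (simp_all add: improves_without_def)
    then have le': "a * entry_profit c (q $ i) \<le> a * entry_profit c (q' $ i)"
      "b * entry_profit c (r $ i) \<le> b * entry_profit c (r' $ i)"
      using ab by (simp_all add: mult_left_mono)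
    then show "a * entry_profit c (q $ i) + b * entry_profit c (r $ i)
      \<le> a * entry_profit c (q' $ i) + b * entry_profit c (r' $ i)"
      by simp
    assume "\<exists>j\<in>D. fst ((a *\<^sub>R q + b *\<^sub>R r) $ i) $ j \<noteq> 0"
    then obtain j where j: "j \<in> D" "a * fst (q $ i) $ j \<noteq> 0 \<or> b * fst (r $ i) $ j \<noteq> 0"
      by force
    then have "(0 < a \<and> entry_profit c (q $ i) < entry_profit c (q' $ i)) \<or>
      (0 < b \<and> entry_profit c (r $ i) < entry_profit c (r' $ i))"
      using qr ab by (force simp: improves_without_def)
    then have "a * entry_profit c (q $ i) < a * entry_profit c (q' $ i) \<or>
      b * entry_profit c (r $ i) < b * entry_profit c (r' $ i)"
      by (auto intro: mult_strict_left_mono)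
    with le' show "a * entry_profit c (q $ i) + b * entry_profit c (r $ i)
      < a * entry_profit c (q' $ i) + b * entry_profit c (r' $ i)"
      by linarith
  qed
  then show "a *\<^sub>R q + b *\<^sub>R r \<in> {q \<in> Q. \<exists>q'\<in>Q. improves_without D c q' q}"
    using qr ab convexD[OF \<open>convex Q\<close>] by blast
qed

text \<open>The threshold \<open>H\<close> is fixed before the costs \<open>c\<close>, because in
  the application the costs of foreign copies are set from it. Of the costs outside \<open>D\<close>
  only the bound \<open>C\<close> on their sum enters.\<close>

lemma ic_profile_improvement:
  fixes v :: "'n::finite \<Rightarrow> 'h::finite \<Rightarrow> real" and D :: "'h set" and C :: real
  assumes v: "\<And>i j. 0 \<le> v i j"
  shows "\<exists>H. \<forall>c. (\<forall>j. 0 \<le> c j) \<longrightarrow> (\<forall>j\<in>D. H \<le> c j) \<longrightarrow> (\<Sum>j\<in>-D. c j) \<le> C \<longrightarrow>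
    (\<forall>q\<in>ic_profiles v. \<exists>q'\<in>ic_profiles v. improves_without D c q' q)"
proof -
  obtain V where V: "finite V" "ic_profiles v = convex hull V"
    using vertices_ic_profiles[OF v] .
  define E where "E = (\<lambda>(q, i, j). fst (q $ i) $ j) ` (V \<times> UNIV \<times> UNIV) - {0}"
  \<comment> \<open>The least positive quantity at a generator. Inserting \<open>1\<close> keeps the
    minimum meaningful when \<open>E\<close> is empty.\<close>
  define \<eta> where "\<eta> = Min (insert 1 E)"
  have nonneg: "0 \<le> fst (q $ i) $ j" if "q \<in> ic_profiles v" for q i j
    using that by (simp add: ic_profiles_def)
  have V_sub: "V \<subseteq> ic_profiles v"
    using hull_subset[of V convex] V by simp
  have "finite E"
    using V by (simp add: E_def)
  moreover have "0 < e" if "e \<in> E" for e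
    using that nonneg V_sub by (fastforce simp: E_def less_le)
  ultimately have eta: "0 < \<eta>" "\<And>e. e \<in> E \<Longrightarrow> \<eta> \<le> e"
    by (auto simp: \<eta>_def)
  have *: "ic_profiles v \<subseteq> {q \<in> ic_profiles v. \<exists>q'\<in>ic_profiles v. improves_without D c q' q}"
    if c: "\<And>j. 0 \<le> c j" "(\<Sum>j\<in>-D. c j) \<le> C"
      "\<And>j. j \<in> D \<Longrightarrow> ((\<Sum>i\<in>UNIV. \<Sum>j\<in>UNIV. v i j) + C + 1) / \<eta> \<le> c j" for c
  proof -
    have "convex hull V \<subseteq> {q \<in> ic_profiles v. \<exists>q'\<in>ic_profiles v. improves_without D c q' q}"
    proof (rule hull_minimal)
      show "convex {q \<in> ic_profiles v. \<exists>q'\<in>ic_profiles v. improves_without D c q' q}"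
        by (intro convex_improvable polyhedron_imp_convex polyhedron_ic_profiles nonneg)
      show "V \<subseteq> {q \<in> ic_profiles v. \<exists>q'\<in>ic_profiles v. improves_without D c q' q}"
      proof
        fix q assume "q \<in> V"
        have "\<eta> \<le> fst (q $ i) $ j" if "fst (q $ i) $ j \<noteq> 0" for i j
          using that \<open>q \<in> V\<close> by (auto intro!: eta(2) rev_image_eqI[of "(q, i, j)"] simp: E_def)
        moreover have "q \<in> ic_profiles v"
          using V_sub \<open>q \<in> V\<close> by blast
        ultimately
        show "q \<in> {q \<in> ic_profiles v. \<exists>q'\<in>ic_profiles v. improves_without D c q' q}"
          using ic_profile_improvement_vertex[of v c D C q \<eta>] v c eta(1) by blast
      qed
    qed
    then show ?thesis using V by simp
  qed
  show ?thesis
    using * by blast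
qed

section \<open>Optimal choices and profits from a menu\<close>

lemma sum_pmf_mult_le:
  fixes p :: "'a::finite pmf" and f :: "'a \<Rightarrow> real"
  assumes "\<And>a. a \<in> set_pmf p \<Longrightarrow> f a \<le> b"
  shows "(\<Sum>a\<in>UNIV. pmf p a * f a) \<le> b"
proof -
  have "(\<Sum>a\<in>UNIV. pmf p a * f a) \<le> (\<Sum>a\<in>UNIV. pmf p a * b)"
  proof (rule sum_mono)
    fix a show "pmf p a * f a \<le> pmf p a * b"
      using assms[of a] by (cases "a \<in> set_pmf p") (auto simp: set_pmf_iff intro: mult_left_mono)
  qed
  also have "\<dots> = b"
    by (simp flip: sum_distrib_right add: sum_pmf_eq_1)
  finally show ?thesis .
qed

lemma sum_pmf_mult_ge:
  fixes p :: "'a::finite pmf" and f :: "'a \<Rightarrow> real"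
  assumes "\<And>a. a \<in> set_pmf p \<Longrightarrow> b \<le> f a"
  shows "b \<le> (\<Sum>a\<in>UNIV. pmf p a * f a)"
  using sum_pmf_mult_le[of p "\<lambda>a. - f a" "- b"] assms by (simp add: sum_negf)

lemma sum_pmf_mult_eq:
  fixes p :: "'a::finite pmf" and f :: "'a \<Rightarrow> real"
  assumes "\<And>a. a \<in> set_pmf p \<Longrightarrow> f a = b"
  shows "(\<Sum>a\<in>UNIV. pmf p a * f a) = b"
  using sum_pmf_mult_le[of p f b] sum_pmf_mult_ge[of p b f] assms by force

lemma sum_pmf_mult_abs_le:
  fixes p :: "'a::finite pmf" and f :: "'a \<Rightarrow> real"
  assumes "\<And>a. a \<in> set_pmf p \<Longrightarrow> \<bar>f a\<bar> \<le> b"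
  shows "\<bar>\<Sum>a\<in>UNIV. pmf p a * f a\<bar> \<le> b"
proof -
  have "(\<Sum>a\<in>UNIV. pmf p a * f a) \<le> b"
    using assms by (intro sum_pmf_mult_le) (auto simp: abs_le_iff)
  moreover have "- b \<le> (\<Sum>a\<in>UNIV. pmf p a * f a)"
    using assms by (intro sum_pmf_mult_ge) (force simp: abs_le_iff)
  ultimately show ?thesis by linarith
qed

lemma buyer_payoff_simps [simp]:
  "buyer_payoff v \<mu> None = 0"
  "buyer_payoff v \<mu> (Some i) = - enn2real (snd (\<mu> i)) + (\<Sum>j\<in>UNIV. fst (\<mu> i) j * v j)"
  by (simp_all add: buyer_payoff_def)

lemma seller_payoff_simps [simp]:
  "seller_payoff c \<mu> None = 0"
  "seller_payoff c \<mu> (Some i) = enn2real (snd (\<mu> i)) - (\<Sum>j\<in>UNIV. fst (\<mu> i) j * c j)"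
  by (simp_all add: seller_payoff_def)

lemma offered_simps [simp]:
  "None \<in> offered \<mu>" "Some i \<in> offered \<mu> \<longleftrightarrow> snd (\<mu> i) \<noteq> \<infinity>"
  by (auto simp: offered_def)

lemma space_menu_space: "\<mu> \<in> space menu_space \<longleftrightarrow> (\<forall>i j. fst (\<mu> i) j \<in> {0..1})"
  by (simp add: menu_space_def space_restrict_space)

lemma allocation_bounds:
  assumes "\<mu> \<in> space menu_space"
  shows "0 \<le> fst (\<mu> i) j" "fst (\<mu> i) j \<le> 1"
  using assms by (simp_all add: space_menu_space)

definition best :: "('g::finite \<Rightarrow> real) \<Rightarrow> ('n, 'g) menu \<Rightarrow> 'n option set" where
  "best v \<mu> = {a \<in> offered \<mu>. \<forall>a'\<in>offered \<mu>. buyer_payoff v \<mu> a' \<le> buyer_payoff v \<mu> a}"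

definition buyer_max :: "('g::finite \<Rightarrow> real) \<Rightarrow> ('n, 'g) menu \<Rightarrow> real" where
  "buyer_max v \<mu> = Max (buyer_payoff v \<mu> ` offered \<mu>)"

text \<open>The profit when ties among the buyer's best options are broken in favour of the
  seller.\<close>

definition seller_max ::
    "('g::finite \<Rightarrow> real) \<Rightarrow> ('g \<Rightarrow> real) \<Rightarrow> ('n, 'g) menu \<Rightarrow> real" where
  "seller_max v c \<mu> = Max (seller_payoff c \<mu> ` best v \<mu>)"

context
  fixes v c :: "'g::finite \<Rightarrow> real" and \<mu> :: "('n::finite, 'g) menu"
begin

lemma best_subset_offered: "best v \<mu> \<subseteq> offered \<mu>"
  by (auto simp: best_def)

lemma buyer_payoff_le_max: "a \<in> offered \<mu> \<Longrightarrow> buyer_payoff v \<mu> a \<le> buyer_max v \<mu>"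
  by (simp add: buyer_max_def)

lemma buyer_max_attained: "\<exists>a\<in>offered \<mu>. buyer_payoff v \<mu> a = buyer_max v \<mu>"
proof -
  have "buyer_max v \<mu> \<in> buyer_payoff v \<mu> ` offered \<mu>"
    unfolding buyer_max_def by (intro Max_in) (auto simp: offered_def)
  then show ?thesis by force
qed

lemma best_iff: "a \<in> best v \<mu> \<longleftrightarrow> a \<in> offered \<mu> \<and> buyer_payoff v \<mu> a = buyer_max v \<mu>"
  using buyer_payoff_le_max buyer_max_attained unfolding best_def by force

lemma seller_payoff_le_max: "a \<in> best v \<mu> \<Longrightarrow> seller_payoff c \<mu> a \<le> seller_max v c \<mu>"
  by (simp add: seller_max_def)

lemma seller_max_attained: "\<exists>a\<in>best v \<mu>. seller_payoff c \<mu> a = seller_max v c \<mu>"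
proof -
  have "best v \<mu> \<noteq> {}"
    using buyer_max_attained by (auto simp: best_iff)
  then have "seller_max v c \<mu> \<in> seller_payoff c \<mu> ` best v \<mu>"
    unfolding seller_max_def by (intro Max_in) auto
  then show ?thesis by force
qed

text \<open>A mean of values below a maximum reaches it only if the support consists of maximisers.
  This turns the condition in \<open>optimal_choices\<close> into one on supports.\<close>

lemma optimal_pmf_iff:
  assumes "set_pmf p \<subseteq> offered \<mu>"
  shows "(\<forall>a\<in>offered \<mu>. buyer_payoff v \<mu> a \<le> (\<Sum>a'\<in>UNIV. pmf p a' * buyer_payoff v \<mu> a'))
    \<longleftrightarrow> set_pmf p \<subseteq> best v \<mu>"
proof
  assume *: "\<forall>a\<in>offered \<mu>. buyer_payoff v \<mu> a \<le> (\<Sum>a'\<in>UNIV. pmf p a' * buyer_payoff v \<mu> a')"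
  then have ge: "buyer_max v \<mu> \<le> (\<Sum>a\<in>UNIV. pmf p a * buyer_payoff v \<mu> a)"
    using buyer_max_attained by force
  show "set_pmf p \<subseteq> best v \<mu>"
  proof
    fix a assume a: "a \<in> set_pmf p"
    show "a \<in> best v \<mu>"
    proof (rule ccontr)
      assume "a \<notin> best v \<mu>"
      then have less: "buyer_payoff v \<mu> a < buyer_max v \<mu>"
        using a assms buyer_payoff_le_max[of a] by (force simp: best_iff)
      have "(\<Sum>a\<in>UNIV. pmf p a * buyer_payoff v \<mu> a) < (\<Sum>a\<in>UNIV. pmf p a * buyer_max v \<mu>)"
      proof (rule sum_strict_mono_ex1)
        have "pmf p a' * buyer_payoff v \<mu> a' \<le> pmf p a' * buyer_max v \<mu>" for a'
          using assms buyer_payoff_le_max[of a']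
          by (cases "a' \<in> set_pmf p") (auto simp: set_pmf_iff intro: mult_left_mono)
        then show "\<forall>a'\<in>UNIV. pmf p a' * buyer_payoff v \<mu> a' \<le> pmf p a' * buyer_max v \<mu>"
          by simp
        have "pmf p a * buyer_payoff v \<mu> a < pmf p a * buyer_max v \<mu>"
          using less a by (intro mult_strict_left_mono) (auto simp: pmf_positive)
        then show "\<exists>a\<in>UNIV. pmf p a * buyer_payoff v \<mu> a < pmf p a * buyer_max v \<mu>"
          by blast
      qed simp
      also have "\<dots> = buyer_max v \<mu>"
        by (rule sum_pmf_mult_eq) simp
      finally show False using ge by simp
    qed
  qed
next
  assume "set_pmf p \<subseteq> best v \<mu>"
  then have "(\<Sum>a\<in>UNIV. pmf p a * buyer_payoff v \<mu> a) = buyer_max v \<mu>"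
    by (intro sum_pmf_mult_eq) (auto simp: best_iff)
  then show "\<forall>a\<in>offered \<mu>. buyer_payoff v \<mu> a \<le> (\<Sum>a'\<in>UNIV. pmf p a' * buyer_payoff v \<mu> a')"
    using buyer_payoff_le_max by simp
qed

lemma sum_pmf_best:
  "set_pmf p \<subseteq> best v \<mu> \<Longrightarrow> (\<Sum>a\<in>UNIV. pmf p a * buyer_payoff v \<mu> a) = buyer_max v \<mu>"
  by (intro sum_pmf_mult_eq) (auto simp: best_iff)

lemma buyer_max_nonneg: "0 \<le> buyer_max v \<mu>"
  using buyer_payoff_le_max[of None] by simp

context
  assumes v_nonneg: "\<And>j. 0 \<le> v j" and menu: "\<mu> \<in> space menu_space"
begin

lemma buyer_payoff_le: "buyer_payoff v \<mu> a \<le> (\<Sum>j\<in>UNIV. v j)"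
proof (cases a)
  case None
  then show ?thesis using v_nonneg by (simp add: sum_nonneg)
next
  case (Some i)
  have "(\<Sum>j\<in>UNIV. fst (\<mu> i) j * v j) \<le> (\<Sum>j\<in>UNIV. v j)"
    by (intro sum_mono mult_left_le_one_le v_nonneg allocation_bounds menu)
  moreover have "0 \<le> enn2real (snd (\<mu> i))" by simp
  ultimately show ?thesis unfolding Some buyer_payoff_simps by linarith
qed

lemma buyer_max_abs_le: "\<bar>buyer_max v \<mu>\<bar> \<le> (\<Sum>j\<in>UNIV. v j)"
proof -
  obtain a where "buyer_payoff v \<mu> a = buyer_max v \<mu>"
    using buyer_max_attained by blast
  then show ?thesis
    using buyer_payoff_le[of a] buyer_max_nonneg by simp
qed

context
  assumes c_nonneg: "\<And>j. 0 \<le> c j"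
begin

text \<open>A best option leaves the buyer at least \<open>0\<close>, so its price is at most its
  value to him. The bound does not depend on the menu, which makes profits integrable under every
  mixture of menus.\<close>

lemma seller_payoff_abs_le:
  assumes "a \<in> best v \<mu>"
  shows "\<bar>seller_payoff c \<mu> a\<bar> \<le> (\<Sum>j\<in>UNIV. v j) + (\<Sum>j\<in>UNIV. c j)"
proof (cases a)
  case None
  then show ?thesis using v_nonneg c_nonneg by (simp add: sum_nonneg)
next
  case (Some i)
  have "0 \<le> buyer_payoff v \<mu> a"
    using assms buyer_max_nonneg by (simp add: best_iff)
  moreover have "(\<Sum>j\<in>UNIV. fst (\<mu> i) j * v j) \<le> (\<Sum>j\<in>UNIV. v j)"
    "(\<Sum>j\<in>UNIV. fst (\<mu> i) j * c j) \<le> (\<Sum>j\<in>UNIV. c j)"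
    by (intro sum_mono mult_left_le_one_le v_nonneg c_nonneg allocation_bounds menu)+
  moreover have "0 \<le> enn2real (snd (\<mu> i))" by simp
  moreover have "0 \<le> (\<Sum>j\<in>UNIV. fst (\<mu> i) j * c j)"
    by (intro sum_nonneg mult_nonneg_nonneg c_nonneg allocation_bounds menu)
  moreover have "0 \<le> (\<Sum>j\<in>UNIV. v j)"
    using v_nonneg c_nonneg by (simp add: sum_nonneg)
  ultimately show ?thesis
    unfolding Some seller_payoff_simps buyer_payoff_simps abs_le_iff by linarith
qed

lemma seller_max_abs_le: "\<bar>seller_max v c \<mu>\<bar> \<le> (\<Sum>j\<in>UNIV. v j) + (\<Sum>j\<in>UNIV. c j)"
  using seller_max_attained seller_payoff_abs_le by fastforce

end

end

end

text \<open>Ceding a small share of the profit to the buyer breaks his ties in favour of the seller.\<close>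

lemma profit_sharing_menu:
  fixes v :: "'n::finite \<Rightarrow> 'g::finite \<Rightarrow> real" and \<mu> :: "('n, 'g) menu"
  assumes c: "\<And>j. 0 \<le> c j" and menu: "\<mu> \<in> space menu_space" and e: "0 < e" "e < 1"
  shows "\<exists>\<mu>'\<in>space (menu_space :: ('n, 'g) menu measure). \<forall>i. \<forall>a\<in>best (v i) \<mu>'.
    (1 - e) * seller_max (v i) c \<mu> \<le> seller_payoff c \<mu>' a"
proof -
  \<comment> \<open>Each finite price is moved towards the cost of its allocation, so that the
    fraction \<open>e\<close> of the profit goes to the buyer. Infinite prices stay infinite, so the
    same options are offered.\<close>
  define \<mu>' :: "('n, 'g) menu" where "\<mu>' i = (fst (\<mu> i), if snd (\<mu> i) = \<infinity> then \<infinity>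
    else ennreal ((1 - e) * enn2real (snd (\<mu> i)) + e * (\<Sum>j\<in>UNIV. fst (\<mu> i) j * c j)))" for i
  have "\<mu>' \<in> space menu_space"
    using menu by (simp add: space_menu_space \<mu>'_def)
  moreover have "(1 - e) * seller_max (v i) c \<mu> \<le> seller_payoff c \<mu>' a" if a: "a \<in> best (v i) \<mu>'" for i a
  proof -
    have off: "a \<in> offered \<mu>' \<longleftrightarrow> a \<in> offered \<mu>" for a
      by (cases a) (auto simp: \<mu>'_def)
    have price: "enn2real (snd (\<mu>' i)) =
      (1 - e) * enn2real (snd (\<mu> i)) + e * (\<Sum>j\<in>UNIV. fst (\<mu> i) j * c j)"
      if "snd (\<mu> i) \<noteq> \<infinity>" for i
    proof -
      have "0 \<le> (\<Sum>j\<in>UNIV. fst (\<mu> i) j * c j)"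
        using menu c by (auto intro!: sum_nonneg simp: space_menu_space)
      then have "0 \<le> (1 - e) * enn2real (snd (\<mu> i)) + e * (\<Sum>j\<in>UNIV. fst (\<mu> i) j * c j)"
        using e by simp
      then show ?thesis
        using that by (simp add: \<mu>'_def del: ennreal_plus)
    qed
    have seller: "seller_payoff c \<mu>' a = (1 - e) * seller_payoff c \<mu> a" if "a \<in> offered \<mu>" for a
      using that by (cases a) (simp_all add: price, simp add: \<mu>'_def algebra_simps)
    have buyer: "buyer_payoff (v i) \<mu>' a = buyer_payoff (v i) \<mu> a + e * seller_payoff c \<mu> a"
      if "a \<in> offered \<mu>" for a
      using that by (cases a) (simp_all add: price, simp add: \<mu>'_def algebra_simps)
    obtain a0 where a0: "a0 \<in> best (v i) \<mu>" "seller_payoff c \<mu> a0 = seller_max (v i) c \<mu>"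
      using seller_max_attained by blast
    have "a \<in> offered \<mu>" "a0 \<in> offered \<mu>"
      using a a0 off best_subset_offered by blast+
    moreover have "buyer_payoff (v i) \<mu>' a0 \<le> buyer_payoff (v i) \<mu>' a"
      using a \<open>a0 \<in> offered \<mu>\<close> off by (simp add: best_def)
    moreover have "buyer_payoff (v i) \<mu> a \<le> buyer_payoff (v i) \<mu> a0"
      using a0 \<open>a \<in> offered \<mu>\<close> by (simp add: best_def)
    \<comment> \<open>At the new prices the buyer maximises his old payoff plus \<open>e\<close>
      times the old profit. Since \<open>a\<close> beats \<open>a0\<close> in this sum although
      \<open>a0\<close> is at least as good for him at the old prices, its profit must be at least
      as large.\<close>
    ultimately have "e * seller_payoff c \<mu> a0 \<le> e * seller_payoff c \<mu> a"
      by (simp add: buyer)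
    then show ?thesis
      using e a0 seller[OF \<open>a \<in> offered \<mu>\<close>] by simp
  qed
  ultimately show ?thesis
    by (intro bexI[of _ \<mu>'] allI ballI)
qed

text \<open>As a supremum it needs no optimal menu to exist. That menus posted in equilibrium almost
  surely attain it follows later, from \<open>AE_optimal_menu\<close>.\<close>

definition seller_opt ::
    "('n::finite \<Rightarrow> 'g::finite \<Rightarrow> real) \<Rightarrow> ('g \<Rightarrow> real) \<Rightarrow> 'n pmf \<Rightarrow> real" where
  "seller_opt v c \<beta> = (SUP \<mu>\<in>space (menu_space :: ('n, 'g) menu measure).
     \<Sum>i\<in>UNIV. pmf \<beta> i * seller_max (v i) c \<mu>)"

lemma seller_opt_upper:
  fixes v :: "'n::finite \<Rightarrow> 'g::finite \<Rightarrow> real" and \<mu> :: "('n, 'g) menu"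
  assumes "\<And>i j. 0 \<le> v i j" "\<And>j. 0 \<le> c j" "\<mu> \<in> space menu_space"
  shows "(\<Sum>i\<in>UNIV. pmf \<beta> i * seller_max (v i) c \<mu>) \<le> seller_opt v c \<beta>"
proof -
  have "(\<Sum>i\<in>UNIV. pmf \<beta> i * seller_max (v i) c \<mu>) \<le> (\<Sum>i\<in>UNIV. \<Sum>j\<in>UNIV. v i j) + (\<Sum>j\<in>UNIV. c j)"
    if "\<mu> \<in> space menu_space" for \<mu> :: "('n, 'g) menu"
  proof (rule sum_pmf_mult_le)
    fix i
    have "seller_max (v i) c \<mu> \<le> (\<Sum>j\<in>UNIV. v i j) + (\<Sum>j\<in>UNIV. c j)"
      using seller_max_abs_le[of "v i" \<mu> c] assms that by simp
    also have "(\<Sum>j\<in>UNIV. v i j) \<le> (\<Sum>i\<in>UNIV. \<Sum>j\<in>UNIV. v i j)"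
      using assms by (intro member_le_sum[of i UNIV "\<lambda>i. \<Sum>j\<in>UNIV. v i j"] sum_nonneg) auto
    finally show "seller_max (v i) c \<mu> \<le> (\<Sum>i\<in>UNIV. \<Sum>j\<in>UNIV. v i j) + (\<Sum>j\<in>UNIV. c j)"
      by simp
  qed
  then show ?thesis
    unfolding seller_opt_def by (intro cSUP_upper[OF assms(3)] bdd_aboveI2)
qed

lemma seller_opt_least:
  fixes v :: "'n::finite \<Rightarrow> 'g::finite \<Rightarrow> real"
  assumes "\<And>\<mu> :: ('n, 'g) menu. \<mu> \<in> space menu_space \<Longrightarrow>
    (\<Sum>i\<in>UNIV. pmf \<beta> i * seller_max (v i) c \<mu>) \<le> b"
  shows "seller_opt v c \<beta> \<le> b"
proof -
  \<comment> \<open>The menu that offers nothing shows that the supremum ranges over a nonempty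
    set.\<close>
  have "(\<lambda>_. (\<lambda>_. 0, \<infinity>)) \<in> space (menu_space :: ('n, 'g) menu measure)"
    by (simp add: space_menu_space)
  then have "space (menu_space :: ('n, 'g) menu measure) \<noteq> {}"
    by blast
  then show ?thesis
    unfolding seller_opt_def using assms by (rule cSUP_least)
qed

section \<open>Measurable dependence on the menu\<close>

lemma measurable_allocation [measurable]:
  "(\<lambda>\<mu>. fst (\<mu> i) j) \<in> borel_measurable (menu_space :: ('n, 'g) menu measure)"
proof -
  have "(\<lambda>\<mu>. fst (\<mu> i) j) \<in> borel_measurable (borel :: ('n, 'g) menu measure)"
    by (rule borel_measurable_continuous_onI, rule continuous_on_product_then_coordinatewise[where i = j],
        rule continuous_on_fst, rule continuous_on_product_coordinates)
  then show ?thesis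
    unfolding menu_space_def by (rule measurable_restrict_space1)
qed

lemma measurable_price [measurable]:
  "(\<lambda>\<mu>. snd (\<mu> i)) \<in> borel_measurable (menu_space :: ('n, 'g) menu measure)"
proof -
  have "(\<lambda>\<mu>. snd (\<mu> i)) \<in> borel_measurable (borel :: ('n, 'g) menu measure)"
    by (rule borel_measurable_continuous_onI, rule continuous_on_snd,
        rule continuous_on_product_coordinates)
  then show ?thesis
    unfolding menu_space_def by (rule measurable_restrict_space1)
qed

lemma measurable_buyer_payoff [measurable]:
  "(\<lambda>\<mu>. buyer_payoff v \<mu> a) \<in> borel_measurable menu_space"
  by (cases a) simp_all

lemma measurable_seller_payoff [measurable]:
  "(\<lambda>\<mu>. seller_payoff c \<mu> a) \<in> borel_measurable menu_space"
  by (cases a) simp_all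

lemma measurable_offered [measurable]: "Measurable.pred menu_space (\<lambda>\<mu>. a \<in> offered \<mu>)"
  by (cases a) simp_all

text \<open>The uniform distribution over the remaining ties is canonical, so that no measurable
  selection is involved.\<close>

definition favourable_choice ::
    "('g::finite \<Rightarrow> real) \<Rightarrow> ('g \<Rightarrow> real) \<Rightarrow> ('n::finite, 'g) menu \<Rightarrow> 'n option pmf" where
  "favourable_choice v c \<mu> = pmf_of_set {a \<in> best v \<mu>. seller_payoff c \<mu> a = seller_max v c \<mu>}"

lemma set_favourable_choice:
  "set_pmf (favourable_choice v c \<mu>) = {a \<in> best v \<mu>. seller_payoff c \<mu> a = seller_max v c \<mu>}"
  unfolding favourable_choice_def using seller_max_attained[of v \<mu> c]
  by (intro set_pmf_of_set) auto

lemma measurable_favourable_choice [measurable]: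
  "(\<lambda>\<mu>. pmf (favourable_choice v c \<mu>) a)
    \<in> borel_measurable (menu_space :: ('n::finite, 'g::finite) menu measure)"
proof -
  \<comment> \<open>The favourable options, written with quantifiers over a finite type and
    comparisons of payoffs instead of maxima, so that membership is a measurable predicate of the
    menu.\<close>
  define Z :: "('n, 'g) menu \<Rightarrow> 'n option set" where
    "Z \<mu> = {a. a \<in> offered \<mu> \<and> (\<forall>a'. a' \<in> offered \<mu> \<longrightarrow> buyer_payoff v \<mu> a' \<le> buyer_payoff v \<mu> a) \<and>
      (\<forall>a'. a' \<in> offered \<mu> \<and> (\<forall>a''. a'' \<in> offered \<mu> \<longrightarrow> buyer_payoff v \<mu> a'' \<le> buyer_payoff v \<mu> a') \<longrightarrow>
        seller_payoff c \<mu> a' \<le> seller_payoff c \<mu> a)}" for \<mu>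
  have Z: "{a \<in> best v \<mu>. seller_payoff c \<mu> a = seller_max v c \<mu>} = Z \<mu>" for \<mu>
  proof -
    have "a \<in> best v \<mu> \<and> seller_payoff c \<mu> a = seller_max v c \<mu> \<longleftrightarrow>
      a \<in> best v \<mu> \<and> (\<forall>a'\<in>best v \<mu>. seller_payoff c \<mu> a' \<le> seller_payoff c \<mu> a)" for a
    proof -
      obtain a0 where "a0 \<in> best v \<mu>" "seller_payoff c \<mu> a0 = seller_max v c \<mu>"
        using seller_max_attained by blast
      then show ?thesis
        using seller_payoff_le_max[of _ v \<mu> c] by (metis antisym)
    qed
    then show ?thesis
      by (simp add: Z_def set_eq_iff) (simp add: best_def Ball_def)
  qed
  have [measurable]: "Measurable.pred menu_space (\<lambda>\<mu>. buyer_payoff v \<mu> a' \<le> buyer_payoff v \<mu> a)"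
    "Measurable.pred menu_space (\<lambda>\<mu>. seller_payoff c \<mu> a' \<le> seller_payoff c \<mu> a)"
    for a a' :: "'n option"
    unfolding pred_def by (intro borel_measurable_le measurable_buyer_payoff measurable_seller_payoff)+
  have pred: "Measurable.pred menu_space (\<lambda>\<mu>. a \<in> Z \<mu>)" for a
    unfolding Z_def mem_Collect_eq by measurable
  have *: "(\<lambda>\<mu>. if a \<in> Z \<mu> then 1 else 0 :: real) \<in> borel_measurable menu_space" for a
    by (intro measurable_If pred[unfolded pred_def] measurable_const) simp_all
  have eq: "pmf (favourable_choice v c \<mu>) a =
      (if a \<in> Z \<mu> then 1 else 0) / (\<Sum>a\<in>UNIV. if a \<in> Z \<mu> then 1 else 0)" for \<mu>
  proof -
    have "{a \<in> best v \<mu>. seller_payoff c \<mu> a = seller_max v c \<mu>} \<noteq> {}"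
      using seller_max_attained[of v \<mu> c] by auto
    moreover have "real (card (Z \<mu>)) = (\<Sum>a\<in>UNIV. if a \<in> Z \<mu> then 1 else 0)"
      by (simp add: sum.If_cases)
    ultimately show ?thesis
      unfolding favourable_choice_def by (simp add: Z indicator_def)
  qed
  show ?thesis
    unfolding eq by (intro borel_measurable_divide borel_measurable_sum *)
qed

lemma sum_favourable_choice_buyer:
  "(\<Sum>a\<in>UNIV. pmf (favourable_choice v c \<mu>) a * buyer_payoff v \<mu> a) = buyer_max v \<mu>"
  by (intro sum_pmf_best) (auto simp: set_favourable_choice)

lemma sum_favourable_choice_seller:
  "(\<Sum>a\<in>UNIV. pmf (favourable_choice v c \<mu>) a * seller_payoff c \<mu> a) = seller_max v c \<mu>"
  by (intro sum_pmf_mult_eq) (auto simp: set_favourable_choice)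

text \<open>The maximum is the mean payoff under a measurable optimal choice, hence a finite sum of
  measurable products. Any cost vector would do for breaking the ties; \<open>v\<close> itself is
  taken.\<close>

lemma measurable_buyer_max [measurable]:
  "buyer_max v \<in> borel_measurable (menu_space :: ('n::finite, 'g::finite) menu measure)"
proof -
  have "(\<lambda>\<mu>. \<Sum>a\<in>UNIV. pmf (favourable_choice v v \<mu>) a * buyer_payoff v \<mu> a)
    \<in> borel_measurable (menu_space :: ('n, 'g) menu measure)"
    by measurable
  then show ?thesis
    by (simp add: sum_favourable_choice_buyer)
qed

lemma measurable_seller_max [measurable]:
  "seller_max v c \<in> borel_measurable (menu_space :: ('n::finite, 'g::finite) menu measure)"
proof -
  have "(\<lambda>\<mu>. \<Sum>a\<in>UNIV. pmf (favourable_choice v c \<mu>) a * seller_payoff c \<mu> a)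
    \<in> borel_measurable (menu_space :: ('n, 'g) menu measure)"
    by measurable
  then show ?thesis
    by (simp add: sum_favourable_choice_seller)
qed

section \<open>Values in the talk phase\<close>

text \<open>Backward recursion over the remaining rounds from terminal values \<open>g\<close>. The
  weights are arbitrary reals, so that one recursion serves both for payoffs with fixed types and
  for values averaged over beliefs.\<close>

primrec walk :: "nat \<Rightarrow> (nat \<Rightarrow> nat list \<Rightarrow> nat \<Rightarrow> real) \<Rightarrow> (nat list \<Rightarrow> real) \<Rightarrow> nat \<Rightarrow> nat list \<Rightarrow> real" where
  "walk M w g 0 h = g h"
| "walk M w g (Suc r) h = (\<Sum>x\<in>{1..M}. w (Suc r) h x * walk M w g r (h @ [x]))"

lemma histories_Nil [simp]: "[] \<in> histories M R"
  by (simp add: histories_def)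

lemma histories_append:
  "h \<in> histories M R \<Longrightarrow> length h < R \<Longrightarrow> x \<in> {1..M} \<Longrightarrow> h @ [x] \<in> histories M R"
  by (auto simp: histories_def)

lemma walk_cong:
  assumes "\<And>h' x. h' \<in> histories M R \<Longrightarrow> length h \<le> length h' \<Longrightarrow> length h' < R \<Longrightarrow> x \<in> {1..M} \<Longrightarrow>
      w (R - length h') h' x = w' (R - length h') h' x"
    and "\<And>h'. h' \<in> histories M R \<Longrightarrow> length h' = R \<Longrightarrow> g h' = g' h'"
    and "h \<in> histories M R" "length h + r = R"
  shows "walk M w g r h = walk M w' g' r h"
  using assms
proof (induction r arbitrary: h)
  case (Suc r)
  have "walk M w g r (h @ [x]) = walk M w' g' r (h @ [x])" if "x \<in> {1..M}" for x
    using Suc.prems that by (intro Suc.IH histories_append) auto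
  moreover have "w (Suc r) h x = w' (Suc r) h x" if "x \<in> {1..M}" for x
  proof -
    have "R - length h = Suc r" "length h < R"
      using Suc.prems(4) by simp_all
    then show ?thesis
      using Suc.prems(1)[of h x] Suc.prems(3) that by simp
  qed
  ultimately show ?case
    by (simp add: walk.simps(2))
qed simp

text \<open>The denominator in Bayes' rule.\<close>

definition predicted :: "'t::finite pmf \<Rightarrow> ('t \<Rightarrow> nat pmf) \<Rightarrow> nat \<Rightarrow> real" where
  "predicted \<beta> \<sigma> x = (\<Sum>t\<in>UNIV. pmf \<beta> t * pmf (\<sigma> t) x)"

lemma predicted_nonneg: "0 \<le> predicted \<beta> \<sigma> x"
  by (simp add: predicted_def sum_nonneg)

lemma predicted_pos_iff: "0 < predicted \<beta> \<sigma> x \<longleftrightarrow> (\<exists>t. 0 < pmf \<beta> t \<and> 0 < pmf (\<sigma> t) x)"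
proof -
  have "0 < predicted \<beta> \<sigma> x \<longleftrightarrow> predicted \<beta> \<sigma> x \<noteq> 0"
    using predicted_nonneg[of \<beta> \<sigma> x] by linarith
  also have "predicted \<beta> \<sigma> x \<noteq> 0 \<longleftrightarrow> (\<exists>t. pmf \<beta> t * pmf (\<sigma> t) x \<noteq> 0)"
    unfolding predicted_def by (subst sum_nonneg_eq_0_iff) auto
  also have "\<dots> \<longleftrightarrow> (\<exists>t. 0 < pmf \<beta> t \<and> 0 < pmf (\<sigma> t) x)"
    by (auto simp: less_le)
  finally show ?thesis .
qed

lemma bayes_update_predicted:
  "bayes_update \<beta> \<sigma> x \<beta>' \<longleftrightarrow>
    (0 < predicted \<beta> \<sigma> x \<longrightarrow> (\<forall>t. pmf \<beta>' t = pmf \<beta> t * pmf (\<sigma> t) x / predicted \<beta> \<sigma> x))"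
  by (simp add: bayes_update_def predicted_def)

text \<open>\<open>own\<close> is the set of rounds in which the player speaks whose value is computed: \<open>even\<close> for the
  seller, \<open>odd\<close> for the buyer.\<close>

definition interim_weight :: "(nat \<Rightarrow> bool) \<Rightarrow> (nat list \<Rightarrow> nat pmf) \<Rightarrow> (nat list \<Rightarrow> 't::finite pmf) \<Rightarrow>
    (nat list \<Rightarrow> 't \<Rightarrow> nat pmf) \<Rightarrow> nat \<Rightarrow> nat list \<Rightarrow> nat \<Rightarrow> real" where
  "interim_weight own m \<beta> \<sigma> r h x = (if own r then pmf (m h) x else predicted (\<beta> h) (\<sigma> h) x)"

abbreviation "interim_value M own m \<beta> \<sigma> \<equiv> walk M (interim_weight own m \<beta> \<sigma>)"

lemma interim_value_Suc:
  "interim_value M own m \<beta> \<sigma> g (Suc r) h = (\<Sum>x\<in>{1..M}.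
    (if own (Suc r) then pmf (m h) x else predicted (\<beta> h) (\<sigma> h) x) *
    interim_value M own m \<beta> \<sigma> g r (h @ [x]))"
  unfolding walk.simps by (intro sum.cong refl) (simp only: interim_weight_def)

declare walk.simps(2) [simp del]

text \<open>One player's half of \<open>consistent_beliefs\<close>: \<beta> is the belief of the
  player who speaks in the rounds \<open>own\<close>, and it concerns the type of the player who
  uses \<sigma>.\<close>

definition belief_consistent :: "nat \<Rightarrow> nat \<Rightarrow> (nat \<Rightarrow> bool) \<Rightarrow> (nat list \<Rightarrow> 't::finite pmf) \<Rightarrow>
    (nat list \<Rightarrow> 't \<Rightarrow> nat pmf) \<Rightarrow> bool" where
  "belief_consistent M R own \<beta> \<sigma> \<longleftrightarrow> (\<forall>h\<in>histories M R. \<forall>x\<in>{1..M}. length h < R \<longrightarrow>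
     (if own (R - length h) then \<beta> (h @ [x]) = \<beta> h
      else bayes_update (\<beta> h) (\<sigma> h) x (\<beta> (h @ [x]))))"

definition valid_messages :: "nat \<Rightarrow> nat \<Rightarrow> (nat list \<Rightarrow> nat pmf) \<Rightarrow> bool" where
  "valid_messages M R m \<longleftrightarrow> (\<forall>h\<in>histories M R. set_pmf (m h) \<subseteq> {1..M})"

text \<open>Only one message is changed, after which play returns to \<open>m\<close>. The condition
  is imposed at all histories, whatever their probability.\<close>

definition one_shot_optimal :: "nat \<Rightarrow> nat \<Rightarrow> (nat \<Rightarrow> bool) \<Rightarrow> (nat list \<Rightarrow> nat pmf) \<Rightarrow>
    (nat list \<Rightarrow> 't::finite pmf) \<Rightarrow> (nat list \<Rightarrow> 't \<Rightarrow> nat pmf) \<Rightarrow> (nat list \<Rightarrow> real) \<Rightarrow> bool" where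
  "one_shot_optimal M R own m \<beta> \<sigma> g \<longleftrightarrow>
     (\<forall>h\<in>histories M R. \<forall>r. length h + Suc r = R \<longrightarrow> own (Suc r) \<longrightarrow> (\<forall>x\<in>{1..M}.
        interim_value M own m \<beta> \<sigma> g r (h @ [x]) \<le> interim_value M own m \<beta> \<sigma> g (Suc r) h))"

lemma one_shot_optimalD:
  "one_shot_optimal M R own m \<beta> \<sigma> g \<Longrightarrow> h \<in> histories M R \<Longrightarrow> length h + Suc r = R \<Longrightarrow>
    own (Suc r) \<Longrightarrow> x \<in> {1..M} \<Longrightarrow>
    interim_value M own m \<beta> \<sigma> g r (h @ [x]) \<le> interim_value M own m \<beta> \<sigma> g (Suc r) h"
  unfolding one_shot_optimal_def by blast

text \<open>Averaging over the opponent's types commutes with the recursion: belief times likelihood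
  equals predicted probability times posterior, and the player's own messages leave his belief
  unchanged. Values thereby become functions of the public history.\<close>

lemma walk_bayes:
  assumes cons: "belief_consistent M R own \<beta> \<sigma>"
    and "h \<in> histories M R" "length h + r = R"
  shows "(\<Sum>t\<in>UNIV. pmf (\<beta> h) t * walk M (\<lambda>r h x. pmf (if own r then m h else \<sigma> h t) x) (g t) r h)
    = interim_value M own m \<beta> \<sigma> (\<lambda>h. \<Sum>t\<in>UNIV. pmf (\<beta> h) t * g t h) r h"
  using assms(2,3)
proof (induction r arbitrary: h)
  case (Suc r)
  let ?W = "\<lambda>t. walk M (\<lambda>r h x. pmf (if own r then m h else \<sigma> h t) x) (g t) r"
  let ?V = "interim_value M own m \<beta> \<sigma> (\<lambda>h. \<Sum>t\<in>UNIV. pmf (\<beta> h) t * g t h) r"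
  have len: "length h < R" "R - length h = Suc r"
    using Suc.prems by simp_all
  have "(\<Sum>t\<in>UNIV. pmf (\<beta> h) t * (pmf (if own (Suc r) then m h else \<sigma> h t) x * ?W t (h @ [x])))
    = interim_weight own m \<beta> \<sigma> (Suc r) h x * ?V (h @ [x])" if x: "x \<in> {1..M}" for x
  proof -
    have IH: "(\<Sum>t\<in>UNIV. pmf (\<beta> (h @ [x])) t * ?W t (h @ [x])) = ?V (h @ [x])"
      using Suc.prems len x by (intro Suc.IH histories_append) auto
    show ?thesis
    proof (cases "own (Suc r)")
      case True
      then have "\<beta> (h @ [x]) = \<beta> h"
        using cons Suc.prems len x by (auto simp: belief_consistent_def)
      then show ?thesis
        using True by (simp add: interim_weight_def flip: IH)
          (simp add: sum_distrib_left algebra_simps)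
    next
      case False
      then have "bayes_update (\<beta> h) (\<sigma> h) x (\<beta> (h @ [x]))"
        using cons Suc.prems len x by (auto simp: belief_consistent_def)
      \<comment> \<open>If the predicted probability is \<open>0\<close>, so is each product on the
        left. The identity thus also holds where Bayes' rule says nothing about the
        posterior.\<close>
      then have "pmf (\<beta> h) t * pmf (\<sigma> h t) x = predicted (\<beta> h) (\<sigma> h) x * pmf (\<beta> (h @ [x])) t" for t
        using predicted_pos_iff[of "\<beta> h" "\<sigma> h" x] predicted_nonneg[of "\<beta> h" "\<sigma> h" x]
        by (cases "0 < predicted (\<beta> h) (\<sigma> h) x") (auto simp: bayes_update_predicted less_le)
      then have *: "pmf (\<beta> h) t * (pmf (\<sigma> h t) x * w)
          = predicted (\<beta> h) (\<sigma> h) x * (pmf (\<beta> (h @ [x])) t * w)" for t w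
        by (metis mult.assoc)
      show ?thesis
        by (simp only: False if_False interim_weight_def IH[symmetric] sum_distrib_left *)
    qed
  qed
  then show ?case
    by (simp add: walk.simps(2) sum_distrib_left) (subst sum.swap, simp)
qed simp

lemma sum_pmf_messages:
  fixes p :: "nat pmf"
  assumes "set_pmf p \<subseteq> {1..M}"
  shows "(\<Sum>x\<in>{1..M}. pmf p x) = 1"
  using assms by (intro sum_pmf_eq_1) auto

lemma sum_pmf_messages_le:
  fixes p :: "nat pmf" and f :: "nat \<Rightarrow> real"
  assumes "set_pmf p \<subseteq> {1..M}" and "\<And>x. x \<in> {1..M} \<Longrightarrow> f x \<le> b"
  shows "(\<Sum>x\<in>{1..M}. pmf p x * f x) \<le> b"
proof -
  have "(\<Sum>x\<in>{1..M}. pmf p x * f x) \<le> (\<Sum>x\<in>{1..M}. pmf p x * b)"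
    using assms by (intro sum_mono mult_left_mono) auto
  also have "\<dots> = b"
    using sum_pmf_messages[OF assms(1)] by (simp flip: sum_distrib_right)
  finally show ?thesis .
qed

text \<open>The one-shot deviation principle, by backward induction. Terminal values
  \<open>g'\<close> below \<open>g\<close> cover deviations that also change the posted menu or the
  final choice.\<close>

lemma one_shot_optimal_imp_le:
  assumes opt: "one_shot_optimal M R own m \<beta> \<sigma> g"
    and m': "valid_messages M R m'"
    and g': "\<And>h. h \<in> histories M R \<Longrightarrow> length h = R \<Longrightarrow> g' h \<le> g h"
    and "h \<in> histories M R" "length h + r = R"
  shows "interim_value M own m' \<beta> \<sigma> g' r h \<le> interim_value M own m \<beta> \<sigma> g r h"
  using assms(4,5)
proof (induction r arbitrary: h)
  case (Suc r)
  have IH: "interim_value M own m' \<beta> \<sigma> g' r (h @ [x]) \<le> interim_value M own m \<beta> \<sigma> g r (h @ [x])"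
    if "x \<in> {1..M}" for x
    using Suc.prems that by (intro Suc.IH histories_append) auto
  show ?case
  proof (cases "own (Suc r)")
    case True
    have "interim_value M own m' \<beta> \<sigma> g' r (h @ [x]) \<le> interim_value M own m \<beta> \<sigma> g (Suc r) h"
      if "x \<in> {1..M}" for x
      using IH[OF that] one_shot_optimalD[OF opt Suc.prems True that] by (rule order_trans)
    then show ?thesis
      using True m' Suc.prems
      by (simp only: interim_value_Suc[of M own m'] if_True) (rule sum_pmf_messages_le, auto simp: valid_messages_def)
  next
    case False
    then show ?thesis
      using IH by (auto simp: interim_value_Suc intro!: sum_mono mult_left_mono predicted_nonneg)
  qed
qed (use g' in simp)

lemma one_shot_optimalI:
  assumes m: "valid_messages M R m"
    and opt: "\<And>m' h r. valid_messages M R m' \<Longrightarrow> h \<in> histories M R \<Longrightarrow> length h + r = R \<Longrightarrow>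
      interim_value M own m' \<beta> \<sigma> g r h \<le> interim_value M own m \<beta> \<sigma> g r h"
  shows "one_shot_optimal M R own m \<beta> \<sigma> g"
  unfolding one_shot_optimal_def
proof (intro ballI allI impI)
  fix h r x
  assume h: "h \<in> histories M R" "length h + Suc r = R" and "own (Suc r)" and x: "x \<in> {1..M}"
  define m' where "m' = m(h := return_pmf x)"
  have "valid_messages M R m'"
    using m x by (auto simp: valid_messages_def m'_def)
  then have "interim_value M own m' \<beta> \<sigma> g (Suc r) h \<le> interim_value M own m \<beta> \<sigma> g (Suc r) h"
    using h by (intro opt)
  \<comment> \<open>From \<open>h @ [x]\<close> on all histories are longer than \<open>h\<close>,
    and there \<open>m'\<close> agrees with \<open>m\<close>.\<close>
  moreover have "interim_value M own m' \<beta> \<sigma> g r (h @ [x]) = interim_value M own m \<beta> \<sigma> g r (h @ [x])"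
    using h x by (intro walk_cong[of M R] histories_append) (auto simp: interim_weight_def m'_def)
  moreover have "interim_value M own m' \<beta> \<sigma> g (Suc r) h = interim_value M own m' \<beta> \<sigma> g r (h @ [x])"
  proof -
    have "pmf (m' h) y = (if y = x then 1 else 0)" for y
      by (simp add: m'_def)
    then show ?thesis
      using x \<open>own (Suc r)\<close>
      by (simp add: interim_value_Suc if_distrib[of "\<lambda>z. z * _"] cong: if_cong)
  qed
  ultimately show "interim_value M own m \<beta> \<sigma> g r (h @ [x]) \<le> interim_value M own m \<beta> \<sigma> g (Suc r) h"
    by simp
qed

text \<open>Here \<open>p h\<close> stands for the probability that the public belief after \<open>h\<close> gives to the player's own
  type. Histories where it is zero are reached from others by his own deviations only.\<close>

lemma reoptimise_excluded:
  fixes p :: "nat list \<Rightarrow> real"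
  assumes M: "1 \<le> M" and m: "valid_messages M R m"
    and opt: "one_shot_optimal M R own m \<beta> \<sigma> g"
    and p_other: "\<And>h x. h \<in> histories M R \<Longrightarrow> length h < R \<Longrightarrow> x \<in> {1..M} \<Longrightarrow>
      \<not> own (R - length h) \<Longrightarrow> p (h @ [x]) = p h"
    and p_own: "\<And>h x. h \<in> histories M R \<Longrightarrow> length h < R \<Longrightarrow> x \<in> {1..M} \<Longrightarrow>
      own (R - length h) \<Longrightarrow> 0 < p h \<Longrightarrow> 0 < pmf (m h) x \<Longrightarrow> 0 < p (h @ [x])"
    and g_le: "\<And>h. h \<in> histories M R \<Longrightarrow> length h = R \<Longrightarrow> g' h \<le> g h"
    and g_eq: "\<And>h. h \<in> histories M R \<Longrightarrow> length h = R \<Longrightarrow> 0 < p h \<Longrightarrow> g' h = g h"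
  shows "\<exists>m'. valid_messages M R m' \<and> (\<forall>h. 0 < p h \<longrightarrow> m' h = m h) \<and>
    one_shot_optimal M R own m' \<beta> \<sigma> g' \<and>
    (\<forall>h\<in>histories M R. \<forall>r. length h + r = R \<longrightarrow> 0 < p h \<longrightarrow>
      interim_value M own m' \<beta> \<sigma> g' r h = interim_value M own m \<beta> \<sigma> g r h)"
proof -
  \<comment> \<open>The intended new values, by backward induction: \<open>m\<close> is kept where
    \<open>0 < p h\<close>, and elsewhere the player moves to the best continuation.\<close>
  define V where "V = rec_nat g' (\<lambda>r v h.
    if own (Suc r) then
      if 0 < p h then \<Sum>x\<in>{1..M}. pmf (m h) x * v (h @ [x]) else Max ((\<lambda>x. v (h @ [x])) ` {1..M})
    else \<Sum>x\<in>{1..M}. predicted (\<beta> h) (\<sigma> h) x * v (h @ [x]))"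
  have V_0: "V 0 h = g' h" for h
    by (simp add: V_def)
  have V_Suc: "V (Suc r) h = (if own (Suc r) then
      if 0 < p h then \<Sum>x\<in>{1..M}. pmf (m h) x * V r (h @ [x]) else Max ((\<lambda>x. V r (h @ [x])) ` {1..M})
    else \<Sum>x\<in>{1..M}. predicted (\<beta> h) (\<sigma> h) x * V r (h @ [x]))" for r h
    by (simp add: V_def)
  \<comment> \<open>Once the message at \<open>h\<close> is sent, \<open>R - length h - 1\<close>
    rounds remain.\<close>
  define best_msg where "best_msg h = (SOME x. x \<in> {1..M} \<and>
    V (R - length h - 1) (h @ [x]) = Max ((\<lambda>x. V (R - length h - 1) (h @ [x])) ` {1..M}))" for h
  have best_msg: "best_msg h \<in> {1..M} \<and> V (R - length h - 1) (h @ [best_msg h])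
    = Max ((\<lambda>x. V (R - length h - 1) (h @ [x])) ` {1..M})" for h
  proof -
    have "Max ((\<lambda>x. V (R - length h - 1) (h @ [x])) ` {1..M}) \<in> (\<lambda>x. V (R - length h - 1) (h @ [x])) ` {1..M}"
      using M by (intro Max_in) auto
    then show ?thesis
      unfolding best_msg_def by (intro someI_ex[of "\<lambda>x. x \<in> {1..M} \<and> _ x"]) force
  qed
  define m' where "m' h = (if 0 < p h then m h else return_pmf (best_msg h))" for h
  have m': "valid_messages M R m'"
    using m best_msg by (auto simp: valid_messages_def m'_def)
  have V_value: "interim_value M own m' \<beta> \<sigma> g' r h = V r h"
    if "h \<in> histories M R" "length h + r = R" for h r
    using that
  proof (induction r arbitrary: h)
    case (Suc r)
    have IH: "interim_value M own m' \<beta> \<sigma> g' r (h @ [x]) = V r (h @ [x])" if "x \<in> {1..M}" for x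
      using Suc.prems that by (intro Suc.IH histories_append) auto
    have "(\<Sum>x\<in>{1..M}. pmf (return_pmf (best_msg h)) x * V r (h @ [x])) = Max ((\<lambda>x. V r (h @ [x])) ` {1..M})"
    proof -
      have "R - length h - 1 = r"
        using Suc.prems by simp
      then have "best_msg h \<in> {1..M}" "V r (h @ [best_msg h]) = Max ((\<lambda>x. V r (h @ [x])) ` {1..M})"
        using best_msg[of h] by auto
      moreover have "(\<Sum>x\<in>{1..M}. pmf (return_pmf (best_msg h)) x * V r (h @ [x]))
          = (\<Sum>x\<in>{1..M}. if x = best_msg h then V r (h @ [best_msg h]) else 0)"
        by (intro sum.cong) (auto simp: indicator_def)
      ultimately show ?thesis by simp
    qed
    moreover have "m' h = (if 0 < p h then m h else return_pmf (best_msg h))"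
      by (rule m'_def)
    ultimately show ?case
      using IH by (simp add: V_Suc interim_value_Suc)
  qed (simp add: V_0)
  \<comment> \<open>Values cannot rise, because the old value at \<open>h\<close> dominates all
    continuations and terminal values only fall. Where \<open>0 < p h\<close> they do not fall
    either: the messages that \<open>m\<close> really sends and all messages of the opponent keep
    \<open>p\<close> positive, down to terminal histories, at which \<open>g'\<close> equals
    \<open>g\<close>.\<close>
  have V_le_eq: "V r h \<le> interim_value M own m \<beta> \<sigma> g r h \<and>
      (0 < p h \<longrightarrow> V r h = interim_value M own m \<beta> \<sigma> g r h)"
    if "h \<in> histories M R" "length h + r = R" for h r
    using that
  proof (induction r arbitrary: h)
    case (Suc r)
    let ?U = "interim_value M own m \<beta> \<sigma> g"
    have len: "length h < R" "R - length h = Suc r"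
      using Suc.prems by simp_all
    have IH: "V r (h @ [x]) \<le> ?U r (h @ [x])" "0 < p (h @ [x]) \<longrightarrow> V r (h @ [x]) = ?U r (h @ [x])"
      if "x \<in> {1..M}" for x
      using Suc.IH[of "h @ [x]"] Suc.prems that by (simp_all add: histories_append)
    have eq: "V (Suc r) h = ?U (Suc r) h" if "0 < p h"
    proof (cases "own (Suc r)")
      case True
      have "pmf (m h) x * V r (h @ [x]) = pmf (m h) x * ?U r (h @ [x])" if "x \<in> {1..M}" for x
        using IH[OF that] p_own[OF Suc.prems(1) len(1) that] len True \<open>0 < p h\<close>
        by (cases "pmf (m h) x = 0") (auto simp: less_le)
      then show ?thesis
        using True that by (auto simp: V_Suc interim_value_Suc intro!: sum.cong)
    next
      case False
      then have "V r (h @ [x]) = ?U r (h @ [x])" if "x \<in> {1..M}" for x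
        using IH[OF that] p_other[OF Suc.prems(1) len(1) that] len \<open>0 < p h\<close> by simp
      then show ?thesis
        using False by (simp add: V_Suc interim_value_Suc)
    qed
    moreover have "V (Suc r) h \<le> ?U (Suc r) h" if "\<not> 0 < p h"
    proof (cases "own (Suc r)")
      case True
      have "V r (h @ [x]) \<le> ?U (Suc r) h" if "x \<in> {1..M}" for x
        using IH(1)[OF that] one_shot_optimalD[OF opt Suc.prems True that] by (rule order_trans)
      then show ?thesis
        using True that M by (subst V_Suc) simp
    next
      case False
      then show ?thesis
        using IH(1) by (simp add: V_Suc interim_value_Suc)
          (intro sum_mono mult_left_mono predicted_nonneg, simp)
    qed
    ultimately show ?case by force
  qed (use g_le g_eq in \<open>auto simp: V_0\<close>)
  have "one_shot_optimal M R own m' \<beta> \<sigma> g'"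
    unfolding one_shot_optimal_def
  proof (intro ballI allI impI)
    fix h r x
    assume h: "h \<in> histories M R" "length h + Suc r = R" and own: "own (Suc r)" and x: "x \<in> {1..M}"
    have "V r (h @ [x]) \<le> V (Suc r) h"
    proof (cases "0 < p h")
      case True
      \<comment> \<open>Continuations have become no more attractive, while the value at
        \<open>h\<close> is the old one.\<close>
      have "V r (h @ [x]) \<le> interim_value M own m \<beta> \<sigma> g r (h @ [x])"
        using V_le_eq[of "h @ [x]" r] h x by (simp add: histories_append)
      also have "\<dots> \<le> interim_value M own m \<beta> \<sigma> g (Suc r) h"
        using one_shot_optimalD[OF opt h own x] .
      also have "\<dots> = V (Suc r) h"
        using V_le_eq[of h "Suc r"] h True by simp
      finally show ?thesis .
    next
      case False
      then show ?thesis
        using own x by (simp add: V_Suc)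
    qed
    then show "interim_value M own m' \<beta> \<sigma> g' r (h @ [x]) \<le> interim_value M own m' \<beta> \<sigma> g' (Suc r) h"
      using V_value[of "h @ [x]" r] V_value[of h "Suc r"] h x by (simp only: histories_append length_append) simp
  qed
  then show ?thesis
    using m' V_value V_le_eq by (intro exI[of _ m']) (simp add: m'_def)
qed

section \<open>One-shot characterisation of equilibrium\<close>

definition regular_game :: "('n, 'l, 'g, 's) talk_game \<Rightarrow> bool" where
  "regular_game G \<longleftrightarrow> (\<forall>k j. 0 \<le> cost G k j) \<and> (\<forall>i k j. 0 \<le> buyer_val G i k j)"

lemma cost_nonneg: "regular_game G \<Longrightarrow> 0 \<le> cost G k j"
  by (simp add: regular_game_def)

lemma buyer_val_nonneg: "regular_game G \<Longrightarrow> 0 \<le> buyer_val G i k j"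
  by (simp add: regular_game_def)

lemma expected_payoff_eq_walk:
  "expected_payoff G M b s i k f r h =
    walk M (\<lambda>r h x. pmf (if even r then seller_msg s h k else buyer_msg b h i) x)
      (\<lambda>h. \<integral>\<mu>. (\<Sum>a\<in>UNIV. pmf (buyer_choice b h (signal G k) \<mu> i) a * f \<mu> a) \<partial>seller_menu s h k) r h"
  by (induction r arbitrary: h) (simp_all add: walk.simps(2))

lemma consistent_beliefs_iff:
  "consistent_beliefs G M R b s \<beta>B \<beta>S \<longleftrightarrow> \<beta>B [] = buyer_prior G \<and> \<beta>S [] = seller_prior G \<and>
    belief_consistent M R even \<beta>B (buyer_msg b) \<and> belief_consistent M R odd \<beta>S (seller_msg s)"
  by (auto simp: consistent_beliefs_def belief_consistent_def split: if_splits)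

definition seller_terminal :: "('n::finite, 'l, 'g::finite, 's) talk_game \<Rightarrow> ('n, 'g, 's) buyer_strategy \<Rightarrow>
    ('n, 'l, 'g) seller_strategy \<Rightarrow> (nat list \<Rightarrow> 'n pmf) \<Rightarrow> 'l \<Rightarrow> nat list \<Rightarrow> real" where
  "seller_terminal G b s \<beta>B k h = (\<Sum>i\<in>UNIV. pmf (\<beta>B h) i *
    (\<integral>\<mu>. (\<Sum>a\<in>UNIV. pmf (buyer_choice b h (signal G k) \<mu> i) a * seller_payoff (cost G k) \<mu> a) \<partial>seller_menu s h k))"

text \<open>Optimal final choices are built in through \<open>buyer_max\<close>. The value depends
  on the menus \<omega> but not on a buyer strategy, so it can be compared between the two
  games.\<close>

definition buyer_terminal :: "('n::finite, 'l::finite, 'g::finite, 's) talk_game \<Rightarrow>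
    (nat list \<Rightarrow> 'l \<Rightarrow> ('n, 'g) menu measure) \<Rightarrow> (nat list \<Rightarrow> 'l pmf) \<Rightarrow> 'n \<Rightarrow> nat list \<Rightarrow> real" where
  "buyer_terminal G \<omega> \<beta>S i h =
    (\<Sum>k\<in>UNIV. pmf (\<beta>S h) k * (\<integral>\<mu>. buyer_max (buyer_val G i k) \<mu> \<partial>\<omega> h k))"

abbreviation "seller_value G \<beta>B k h \<equiv> seller_opt (\<lambda>i. buyer_val G i k) (cost G k) (\<beta>B h)"

lemma seller_utility_eq_interim:
  assumes "belief_consistent M R even \<beta>B (buyer_msg b)" "h \<in> histories M R" "length h + r = R"
  shows "seller_utility G M R b s (\<beta>B h) k h =
    interim_value M even (\<lambda>h. seller_msg s h k) \<beta>B (buyer_msg b) (seller_terminal G b s \<beta>B k) r h"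
proof -
  have "R - length h = r" using assms by simp
  then show ?thesis
    unfolding seller_utility_def expected_payoff_eq_walk seller_terminal_def
    using walk_bayes[OF assms, of "\<lambda>h. seller_msg s h k"] by simp
qed

lemma buyer_utility_eq_interim:
  assumes "belief_consistent M R odd \<beta>S (seller_msg s)" "h \<in> histories M R" "length h + r = R"
  shows "buyer_utility G M R b s (\<beta>S h) i h =
    interim_value M odd (\<lambda>h. buyer_msg b h i) \<beta>S (seller_msg s)
      (\<lambda>h. \<Sum>k\<in>UNIV. pmf (\<beta>S h) k * (\<integral>\<mu>. (\<Sum>a\<in>UNIV. pmf (buyer_choice b h (signal G k) \<mu> i) a *
        buyer_payoff (buyer_val G i k) \<mu> a) \<partial>seller_menu s h k)) r h"
proof -
  have "R - length h = r" using assms by simp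
  moreover have "walk M (\<lambda>r h x. pmf (if even r then seller_msg s h k else buyer_msg b h i) x) g r h
    = walk M (\<lambda>r h x. pmf (if odd r then buyer_msg b h i else seller_msg s h k) x) g r h" for g k
    by (rule arg_cong[where f = "\<lambda>w. walk M w g r h"]) (intro ext, simp)
  ultimately show ?thesis
    unfolding buyer_utility_def expected_payoff_eq_walk
    by (simp only: walk_bayes[OF assms, of "\<lambda>h. buyer_msg b h i"])
qed

lemma prob_algebra_menu_space:
  assumes "N \<in> space (prob_algebra menu_space)"
  shows "prob_space N" "sets N = sets menu_space" "space N = space menu_space"
  using assms by (auto simp: space_prob_algebra dest: sets_eq_imp_space_eq)

lemma integrable_menu:
  fixes f :: "('n, 'g) menu \<Rightarrow> real"
  assumes N: "N \<in> space (prob_algebra menu_space)" and f: "f \<in> borel_measurable menu_space"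
    and bound: "\<And>\<mu>. \<mu> \<in> space menu_space \<Longrightarrow> \<bar>f \<mu>\<bar> \<le> B"
  shows "integrable N f"
proof -
  interpret prob_space N
    using N by (rule prob_algebra_menu_space)
  show ?thesis
  proof (rule integrable_const_bound)
    show "AE \<mu> in N. norm (f \<mu>) \<le> B"
      using bound prob_algebra_menu_space(3)[OF N] by (intro AE_I2) simp
    show "f \<in> borel_measurable N"
      using f prob_algebra_menu_space(2)[OF N] measurable_cong_sets by blast
  qed
qed

lemma measurable_choice:
  assumes "valid_buyer_strategy M R b" "h \<in> histories M R"
  shows "(\<lambda>\<mu>. pmf (buyer_choice b h t \<mu> i) a) \<in> borel_measurable menu_space"
  using assms unfolding valid_buyer_strategy_def by blast

lemma integrable_buyer_max:
  fixes v :: "'g::finite \<Rightarrow> real"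
  assumes "N \<in> space (prob_algebra menu_space)" "\<And>j. 0 \<le> v j"
  shows "integrable N (buyer_max v :: ('n::finite, 'g) menu \<Rightarrow> real)"
  using assms(1) measurable_buyer_max
  by (rule integrable_menu) (rule buyer_max_abs_le, rule assms(2))

text \<open>A deviating buyer may accept prices that make the integrand nonintegrable. The integral
  is then \<open>0\<close> by convention, still at most the integral of the nonnegative
  \<open>buyer_max\<close>.\<close>

lemma integral_choice_le:
  fixes G :: "('n::finite, 'l, 'g::finite, 's) talk_game"
  assumes regular: "regular_game G" and b': "valid_buyer_strategy M R b'" and h: "h \<in> histories M R" "length h = R"
    and N: "N \<in> space (prob_algebra menu_space)"
  shows "(\<integral>\<mu>. (\<Sum>a\<in>UNIV. pmf (buyer_choice b' h (signal G k) \<mu> i) a *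
    buyer_payoff (buyer_val G i k) \<mu> a) \<partial>N) \<le> (\<integral>\<mu>. buyer_max (buyer_val G i k) \<mu> \<partial>N)"
    (is "(\<integral>\<mu>. ?f \<mu> \<partial>N) \<le> _")
proof (cases "integrable N ?f")
  case True
  show ?thesis
  proof (rule integral_mono[OF True integrable_buyer_max[OF N buyer_val_nonneg[OF regular]]])
    fix \<mu> assume "\<mu> \<in> space N"
    then have "set_pmf (buyer_choice b' h (signal G k) \<mu> i) \<subseteq> offered \<mu>"
      using b' h prob_algebra_menu_space(3)[OF N] unfolding valid_buyer_strategy_def by blast
    then show "?f \<mu> \<le> buyer_max (buyer_val G i k) \<mu>"
      by (intro sum_pmf_mult_le buyer_payoff_le_max) auto
  qed
next
  case False
  have "0 \<le> (\<integral>\<mu>. buyer_max (buyer_val G i k) \<mu> \<partial>N)"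
    by (intro Bochner_Integration.integral_nonneg buyer_max_nonneg)
  then show ?thesis
    using False by (simp add: not_integrable_integral_eq)
qed

text \<open>Ties are broken here as \<open>b\<close> breaks them, in contrast to
  \<open>seller_max\<close>.\<close>

definition menu_profit :: "('n::finite, 'l, 'g::finite, 's) talk_game \<Rightarrow> ('n, 'g, 's) buyer_strategy \<Rightarrow>
    'n pmf \<Rightarrow> nat list \<Rightarrow> 'l \<Rightarrow> ('n, 'g) menu \<Rightarrow> real" where
  "menu_profit G b \<beta> h k \<mu> = (\<Sum>i\<in>UNIV. pmf \<beta> i *
    (\<Sum>a\<in>UNIV. pmf (buyer_choice b h (signal G k) \<mu> i) a * seller_payoff (cost G k) \<mu> a))"

lemma measurable_menu_profit:
  assumes "valid_buyer_strategy M R b" "h \<in> histories M R"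
  shows "menu_profit G b \<beta> h k \<in> borel_measurable menu_space"
  unfolding menu_profit_def[abs_def]
  by (intro borel_measurable_sum borel_measurable_times borel_measurable_const
      measurable_choice[OF assms] measurable_seller_payoff)

lemma valid_buyer_messages: "valid_buyer_strategy M R b \<Longrightarrow> valid_messages M R (\<lambda>h. buyer_msg b h i)"
  by (simp add: valid_buyer_strategy_def valid_messages_def)

lemma valid_seller_messages: "valid_seller_strategy M R s \<Longrightarrow> valid_messages M R (\<lambda>h. seller_msg s h k)"
  by (simp add: valid_seller_strategy_def valid_messages_def)

lemma valid_seller_menu:
  "valid_seller_strategy M R s \<Longrightarrow> h \<in> histories M R \<Longrightarrow> seller_menu s h k \<in> space (prob_algebra menu_space)"
  unfolding valid_seller_strategy_def by blast

lemma belief_consistentI: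
  assumes "consistent_beliefs G M R b s \<beta>B \<beta>S"
  shows "belief_consistent M R even \<beta>B (buyer_msg b)" "belief_consistent M R odd \<beta>S (seller_msg s)"
  using assms by (simp_all add: consistent_beliefs_iff)

context
  fixes G :: "('n::finite, 'l::finite, 'g::finite, 's) talk_game" and M R :: nat
    and b :: "('n, 'g, 's) buyer_strategy"
  assumes regular: "regular_game G" and valid_b: "valid_buyer_strategy M R b"
    and optimal: "optimal_choices G M R b"
begin

lemma choice_subset_best:
  assumes "h \<in> histories M R" "length h = R" "\<mu> \<in> space menu_space"
  shows "set_pmf (buyer_choice b h (signal G k) \<mu> i) \<subseteq> best (buyer_val G i k) \<mu>"
proof -
  have "set_pmf (buyer_choice b h (signal G k) \<mu> i) \<subseteq> offered \<mu>"
    using valid_b assms unfolding valid_buyer_strategy_def by blast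
  then show ?thesis
    using optimal assms unfolding optimal_choices_def by (simp add: optimal_pmf_iff[symmetric])
qed

lemma integral_optimal_choice:
  assumes "h \<in> histories M R" "length h = R" and N: "N \<in> space (prob_algebra menu_space)"
  shows "(\<integral>\<mu>. (\<Sum>a\<in>UNIV. pmf (buyer_choice b h (signal G k) \<mu> i) a *
    buyer_payoff (buyer_val G i k) \<mu> a) \<partial>N) = (\<integral>\<mu>. buyer_max (buyer_val G i k) \<mu> \<partial>N)"
  using assms by (intro Bochner_Integration.integral_cong refl sum_pmf_best choice_subset_best)
    (auto simp: prob_algebra_menu_space)

context
  fixes h :: "nat list"
  assumes h: "h \<in> histories M R" "length h = R"
begin

lemma seller_choice_abs_le:
  assumes "\<mu> \<in> space menu_space"
  shows "\<bar>\<Sum>a\<in>UNIV. pmf (buyer_choice b h (signal G k) \<mu> i) a * seller_payoff (cost G k) \<mu> a\<bar>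
    \<le> (\<Sum>i\<in>UNIV. \<Sum>j\<in>UNIV. buyer_val G i k j) + (\<Sum>j\<in>UNIV. cost G k j)"
proof (rule sum_pmf_mult_abs_le)
  fix a assume "a \<in> set_pmf (buyer_choice b h (signal G k) \<mu> i)"
  then have "\<bar>seller_payoff (cost G k) \<mu> a\<bar> \<le> (\<Sum>j\<in>UNIV. buyer_val G i k j) + (\<Sum>j\<in>UNIV. cost G k j)"
    using choice_subset_best[OF h assms] assms
    by (intro seller_payoff_abs_le) (auto simp: cost_nonneg[OF regular] buyer_val_nonneg[OF regular])
  also have "(\<Sum>j\<in>UNIV. buyer_val G i k j) \<le> (\<Sum>i\<in>UNIV. \<Sum>j\<in>UNIV. buyer_val G i k j)"
    by (intro member_le_sum[of i UNIV "\<lambda>i. \<Sum>j\<in>UNIV. buyer_val G i k j"] sum_nonneg)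
      (auto simp: buyer_val_nonneg[OF regular])
  finally show "\<bar>seller_payoff (cost G k) \<mu> a\<bar> \<le>
    (\<Sum>i\<in>UNIV. \<Sum>j\<in>UNIV. buyer_val G i k j) + (\<Sum>j\<in>UNIV. cost G k j)"
    by simp
qed

lemma integrable_menu_profit:
  assumes "N \<in> space (prob_algebra menu_space)"
  shows "integrable N (menu_profit G b \<beta> h k)"
  using assms measurable_menu_profit[OF valid_b h(1)]
  by (rule integrable_menu) (unfold menu_profit_def, rule sum_pmf_mult_abs_le, rule seller_choice_abs_le)

text \<open>The sum over buyer types may be moved under the integral because the uniform bound makes
  each summand integrable.\<close>

lemma seller_terminal_eq_integral:
  assumes "seller_menu s h k \<in> space (prob_algebra menu_space)"
  shows "seller_terminal G b s \<beta>B k h = (\<integral>\<mu>. menu_profit G b (\<beta>B h) h k \<mu> \<partial>seller_menu s h k)"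
proof -
  have "integrable (seller_menu s h k)
    (\<lambda>\<mu>. \<Sum>a\<in>UNIV. pmf (buyer_choice b h (signal G k) \<mu> i) a * seller_payoff (cost G k) \<mu> a)" for i
    using assms
  proof (rule integrable_menu)
    show "(\<lambda>\<mu>. \<Sum>a\<in>UNIV. pmf (buyer_choice b h (signal G k) \<mu> i) a * seller_payoff (cost G k) \<mu> a)
      \<in> borel_measurable menu_space"
      by (intro borel_measurable_sum borel_measurable_times measurable_choice[OF valid_b h(1)]
          measurable_seller_payoff)
  qed (rule seller_choice_abs_le)
  then show ?thesis
    unfolding seller_terminal_def menu_profit_def by (subst Bochner_Integration.integral_sum) auto
qed

lemma menu_profit_le:
  assumes "\<mu> \<in> space menu_space"
  shows "menu_profit G b \<beta> h k \<mu> \<le> (\<Sum>i\<in>UNIV. pmf \<beta> i * seller_max (buyer_val G i k) (cost G k) \<mu>)"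
  unfolding menu_profit_def
  using choice_subset_best[OF h assms]
  by (intro sum_mono mult_left_mono sum_pmf_mult_le seller_payoff_le_max) auto

lemma menu_profit_le_opt:
  assumes "\<mu> \<in> space menu_space"
  shows "menu_profit G b \<beta> h k \<mu> \<le> seller_opt (\<lambda>i. buyer_val G i k) (cost G k) \<beta>"
  using menu_profit_le[OF assms, of \<beta> k]
    seller_opt_upper[of "\<lambda>i. buyer_val G i k" "cost G k" \<mu> \<beta>] assms
  by (simp add: cost_nonneg[OF regular] buyer_val_nonneg[OF regular])

lemma seller_terminal_le:
  assumes "seller_menu s h k \<in> space (prob_algebra menu_space)"
  shows "seller_terminal G b s \<beta>B k h \<le> seller_value G \<beta>B k h"
proof -
  interpret prob_space "seller_menu s h k"
    using assms by (rule prob_algebra_menu_space)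
  have "(\<integral>\<mu>. menu_profit G b (\<beta>B h) h k \<mu> \<partial>seller_menu s h k) \<le> (\<integral>\<mu>. seller_value G \<beta>B k h \<partial>seller_menu s h k)"
    using assms prob_algebra_menu_space(3)[OF assms]
    by (intro integral_mono integrable_menu_profit menu_profit_le_opt) auto
  then show ?thesis
    using assms by (simp add: seller_terminal_eq_integral prob_space)
qed

text \<open>The gap between optimum and profit is nonnegative with integral \<open>0\<close>, hence
  almost everywhere \<open>0\<close>. The profit under favourable ties lies between the two and so
  equals the optimum as well.\<close>

lemma AE_optimal_menu:
  assumes N: "seller_menu s h k \<in> space (prob_algebra menu_space)"
    and eq: "seller_terminal G b s \<beta>B k h = seller_value G \<beta>B k h"
  shows "AE \<mu> in seller_menu s h k. \<mu> \<in> space menu_space \<and>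
    (\<Sum>i\<in>UNIV. pmf (\<beta>B h) i * seller_max (buyer_val G i k) (cost G k) \<mu>) = seller_value G \<beta>B k h"
proof -
  interpret prob_space "seller_menu s h k"
    using N by (rule prob_algebra_menu_space)
  let ?W = "seller_value G \<beta>B k h"
  let ?p = "menu_profit G b (\<beta>B h) h k"
  have int: "integrable (seller_menu s h k) ?p"
    using N by (rule integrable_menu_profit)
  have "(\<integral>\<mu>. ?W - ?p \<mu> \<partial>seller_menu s h k) = 0"
    using N eq int by (simp add: seller_terminal_eq_integral prob_space)
  then have "AE \<mu> in seller_menu s h k. ?W - ?p \<mu> = 0"
    using int prob_algebra_menu_space(3)[OF N]
    by (subst (asm) integral_nonneg_eq_0_iff_AE) (auto intro!: AE_I2 menu_profit_le_opt)
  moreover have "AE \<mu> in seller_menu s h k. \<mu> \<in> space menu_space"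
    using prob_algebra_menu_space(3)[OF N] by (intro AE_I2) simp
  ultimately show ?thesis
  proof eventually_elim
    case (elim \<mu>)
    then show ?case
      using menu_profit_le[of \<mu> "\<beta>B h" k] seller_opt_upper[of "\<lambda>i. buyer_val G i k" "cost G k" \<mu> "\<beta>B h"]
      by (simp add: cost_nonneg[OF regular] buyer_val_nonneg[OF regular])
  qed
qed

end

text \<open>At a terminal history the seller could deviate to the profit-sharing variant of any
  menu. Whatever best options \<open>b\<close> selects, this secures almost all of the profit under
  favourable ties, so in equilibrium she gets the supremum.\<close>

lemma seller_terminal_eq_opt:
  assumes cons: "belief_consistent M R even \<beta>B (buyer_msg b)" and s: "valid_seller_strategy M R s"
    and opt: "\<And>s'. valid_seller_strategy M R s' \<Longrightarrow>
      seller_utility G M R b s' (\<beta>B h) k h \<le> seller_utility G M R b s (\<beta>B h) k h"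
    and h: "h \<in> histories M R" "length h = R"
  shows "seller_terminal G b s \<beta>B k h = seller_value G \<beta>B k h"
proof (rule antisym)
  have valid_menu: "seller_menu s h k \<in> space (prob_algebra menu_space)"
    using s h(1) by (rule valid_seller_menu)
  then show "seller_terminal G b s \<beta>B k h \<le> seller_value G \<beta>B k h"
    by (rule seller_terminal_le[OF h])
  have terminal: "seller_utility G M R b s' (\<beta>B h) k h = seller_terminal G b s' \<beta>B k h" for s'
    using seller_utility_eq_interim[OF cons h(1), of 0] h by simp
  show "seller_value G \<beta>B k h \<le> seller_terminal G b s \<beta>B k h"
  proof (rule seller_opt_least)
    fix \<mu> :: "('n, 'g) menu" assume \<mu>: "\<mu> \<in> space menu_space"
    show "(\<Sum>i\<in>UNIV. pmf (\<beta>B h) i * seller_max (buyer_val G i k) (cost G k) \<mu>) \<le> seller_terminal G b s \<beta>B k h"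
    \<comment> \<open>It is enough to secure every share \<open>z < 1\<close> of the profit; the
      share \<open>1 - z\<close> is ceded to the buyer.\<close>
    proof (rule field_le_mult_one_interval)
      fix z :: real assume z: "0 < z" "z < 1"
      obtain \<mu>' :: "('n, 'g) menu" where \<mu>': "\<mu>' \<in> space menu_space"
        "\<And>i a. a \<in> best (buyer_val G i k) \<mu>' \<Longrightarrow>
          z * seller_max (buyer_val G i k) (cost G k) \<mu> \<le> seller_payoff (cost G k) \<mu>' a"
        using profit_sharing_menu[of "cost G k" \<mu> "1 - z" "\<lambda>i. buyer_val G i k"] z \<mu> cost_nonneg[OF regular]
        by auto
      define s' where "s' = s\<lparr>seller_menu := (seller_menu s)(h := (seller_menu s h)(k := return menu_space \<mu>'))\<rparr>"
      have ret: "return menu_space \<mu>' \<in> space (prob_algebra menu_space)"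
        using \<mu>' by (simp add: space_prob_algebra prob_space_return)
      have "valid_seller_strategy M R s'"
        using s ret by (auto simp: valid_seller_strategy_def s'_def)
      then have "seller_terminal G b s' \<beta>B k h \<le> seller_terminal G b s \<beta>B k h"
        using opt by (simp flip: terminal)
      moreover have "seller_terminal G b s' \<beta>B k h = menu_profit G b (\<beta>B h) h k \<mu>'"
      proof -
        have "seller_menu s' h k = return menu_space \<mu>'"
          by (simp add: s'_def)
        then show ?thesis
          using seller_terminal_eq_integral[OF h, of s' k \<beta>B] ret
            integral_return[OF \<mu>'(1) measurable_menu_profit[OF valid_b h(1)]]
          by simp
      qed
      moreover have "(\<Sum>i\<in>UNIV. pmf (\<beta>B h) i * (z * seller_max (buyer_val G i k) (cost G k) \<mu>))
        \<le> menu_profit G b (\<beta>B h) h k \<mu>'"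
        unfolding menu_profit_def using choice_subset_best[OF h \<mu>'(1)]
        by (intro sum_mono mult_left_mono sum_pmf_mult_ge \<mu>'(2)) auto
      ultimately show "z * (\<Sum>i\<in>UNIV. pmf (\<beta>B h) i * seller_max (buyer_val G i k) (cost G k) \<mu>)
        \<le> seller_terminal G b s \<beta>B k h"
        by (simp add: sum_distrib_left mult.left_commute)
    qed
  qed
qed

end

section \<open>The talk phase as a game of its own, with given terminal payoffs\<close>

definition talk_equilibrium :: "nat \<Rightarrow> nat \<Rightarrow> 'n::finite pmf \<Rightarrow> 'l::finite pmf \<Rightarrow>
    (nat list \<Rightarrow> 'n \<Rightarrow> nat pmf) \<Rightarrow> (nat list \<Rightarrow> 'l \<Rightarrow> nat pmf) \<Rightarrow>
    (nat list \<Rightarrow> 'n pmf) \<Rightarrow> (nat list \<Rightarrow> 'l pmf) \<Rightarrow>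
    ('n \<Rightarrow> nat list \<Rightarrow> real) \<Rightarrow> ('l \<Rightarrow> nat list \<Rightarrow> real) \<Rightarrow> bool" where
  "talk_equilibrium M R \<pi>B \<pi>S mB mS \<beta>B \<beta>S gB gS \<longleftrightarrow>
     (\<forall>i. valid_messages M R (\<lambda>h. mB h i)) \<and> (\<forall>k. valid_messages M R (\<lambda>h. mS h k)) \<and>
     \<beta>B [] = \<pi>B \<and> \<beta>S [] = \<pi>S \<and>
     belief_consistent M R even \<beta>B mB \<and> belief_consistent M R odd \<beta>S mS \<and>
     (\<forall>i. one_shot_optimal M R odd (\<lambda>h. mB h i) \<beta>S mS (gB i)) \<and>
     (\<forall>k. one_shot_optimal M R even (\<lambda>h. mS h k) \<beta>B mB (gS k))"

definition talk_utilities :: "nat \<Rightarrow> nat \<Rightarrow> 'n::finite pmf \<Rightarrow> 'l::finite pmf \<Rightarrow>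
    (nat list \<Rightarrow> 'n \<Rightarrow> nat pmf) \<Rightarrow> (nat list \<Rightarrow> 'l \<Rightarrow> nat pmf) \<Rightarrow>
    (nat list \<Rightarrow> 'n pmf) \<Rightarrow> (nat list \<Rightarrow> 'l pmf) \<Rightarrow>
    ('n \<Rightarrow> nat list \<Rightarrow> real) \<Rightarrow> ('l \<Rightarrow> nat list \<Rightarrow> real) \<Rightarrow> real \<times> real" where
  "talk_utilities M R \<pi>B \<pi>S mB mS \<beta>B \<beta>S gB gS =
     (\<Sum>i\<in>UNIV. pmf \<pi>B i * interim_value M odd (\<lambda>h. mB h i) \<beta>S mS (gB i) R [],
      \<Sum>k\<in>UNIV. pmf \<pi>S k * interim_value M even (\<lambda>h. mS h k) \<beta>B mB (gS k) R [])"

definition ex_ante_utilities where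
  "ex_ante_utilities G M R b s =
    (\<Sum>i\<in>UNIV. pmf (buyer_prior G) i * buyer_utility G M R b s (seller_prior G) i [],
     \<Sum>k\<in>UNIV. pmf (seller_prior G) k * seller_utility G M R b s (buyer_prior G) k [])"

context
  fixes G :: "('n::finite, 'l::finite, 'g::finite, 's) talk_game" and M R :: nat
    and b :: "('n, 'g, 's) buyer_strategy" and s :: "('n, 'l, 'g) seller_strategy" and \<beta>B \<beta>S
  assumes regular: "regular_game G" and valid_b: "valid_buyer_strategy M R b"
    and valid_s: "valid_seller_strategy M R s"
    and cons: "consistent_beliefs G M R b s \<beta>B \<beta>S"
    and optimal: "optimal_choices G M R b"
begin

text \<open>Stated for all \<open>b'\<close> that share the final choices of \<open>b\<close>, so
  that it evaluates \<open>b\<close> as well as deviations in messages only.\<close>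

lemma buyer_utility_optimal:
  assumes "h \<in> histories M R" "length h + r = R" "buyer_choice b' = buyer_choice b"
  shows "buyer_utility G M R b' s (\<beta>S h) i h = interim_value M odd (\<lambda>h. buyer_msg b' h i) \<beta>S (seller_msg s)
    (buyer_terminal G (seller_menu s) \<beta>S i) r h"
  unfolding buyer_utility_eq_interim[OF belief_consistentI(2)[OF cons] assms(1,2)] assms(3)
  by (rule walk_cong[of M R, OF refl _ assms(1,2)])
    (simp add: buyer_terminal_def integral_optimal_choice[OF regular valid_b optimal] valid_seller_menu[OF valid_s])

context
  assumes terminal: "\<And>h k. h \<in> histories M R \<Longrightarrow> length h = R \<Longrightarrow>
    seller_terminal G b s \<beta>B k h = seller_value G \<beta>B k h"
begin

lemma seller_utility_optimal:
  assumes "h \<in> histories M R" "length h + r = R" "seller_menu s' = seller_menu s"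
  shows "seller_utility G M R b s' (\<beta>B h) k h =
    interim_value M even (\<lambda>h. seller_msg s' h k) \<beta>B (buyer_msg b) (seller_value G \<beta>B k) r h"
proof -
  have "seller_terminal G b s' \<beta>B k h = seller_terminal G b s \<beta>B k h" for h
    by (simp add: seller_terminal_def assms(3))
  then show ?thesis
    unfolding seller_utility_eq_interim[OF belief_consistentI(1)[OF cons] assms(1,2)]
    by (intro walk_cong[of M R, OF refl _ assms(1,2)]) (simp add: terminal)
qed

lemma ex_ante_utilities_eq:
  "ex_ante_utilities G M R b s = talk_utilities M R (buyer_prior G) (seller_prior G)
    (buyer_msg b) (seller_msg s) \<beta>B \<beta>S (buyer_terminal G (seller_menu s) \<beta>S) (seller_value G \<beta>B)"
  using buyer_utility_optimal[of "[]" R b] seller_utility_optimal[of "[]" R s] cons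
  by (simp add: ex_ante_utilities_def talk_utilities_def consistent_beliefs_iff)

text \<open>Deviations of a single type in messages alone suffice to derive one-shot
  optimality.\<close>

lemma equilibrium_imp_talk_equilibrium:
  assumes "equilibrium G M R b s \<beta>B \<beta>S"
  shows "talk_equilibrium M R (buyer_prior G) (seller_prior G) (buyer_msg b) (seller_msg s) \<beta>B \<beta>S
    (buyer_terminal G (seller_menu s) \<beta>S) (seller_value G \<beta>B)"
proof -
  have "one_shot_optimal M R odd (\<lambda>h. buyer_msg b h i) \<beta>S (seller_msg s) (buyer_terminal G (seller_menu s) \<beta>S i)" for i
  proof (rule one_shot_optimalI)
    fix m' h r assume m': "valid_messages M R m'" and h: "h \<in> histories M R" "length h + r = R"
    define b' where "b' = b\<lparr>buyer_msg := \<lambda>h. (buyer_msg b h)(i := m' h)\<rparr>"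
    have b': "valid_buyer_strategy M R b'"
      using valid_b m' by (auto simp: valid_buyer_strategy_def valid_messages_def b'_def)
    then have "buyer_utility G M R b' s (\<beta>S h) i h \<le> buyer_utility G M R b s (\<beta>S h) i h"
      using assms h by (simp add: equilibrium_def)
    moreover have "buyer_choice b' = buyer_choice b" "(\<lambda>h. buyer_msg b' h i) = m'"
      by (simp_all add: b'_def)
    ultimately show "interim_value M odd m' \<beta>S (seller_msg s) (buyer_terminal G (seller_menu s) \<beta>S i) r h
      \<le> interim_value M odd (\<lambda>h. buyer_msg b h i) \<beta>S (seller_msg s) (buyer_terminal G (seller_menu s) \<beta>S i) r h"
      using buyer_utility_optimal[OF h, of b' i] buyer_utility_optimal[OF h, of b i] by simp
  qed (rule valid_buyer_messages[OF valid_b])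
  moreover have "one_shot_optimal M R even (\<lambda>h. seller_msg s h k) \<beta>B (buyer_msg b) (seller_value G \<beta>B k)" for k
  proof (rule one_shot_optimalI)
    fix m' h r assume m': "valid_messages M R m'" and h: "h \<in> histories M R" "length h + r = R"
    define s' where "s' = s\<lparr>seller_msg := \<lambda>h. (seller_msg s h)(k := m' h)\<rparr>"
    have s': "valid_seller_strategy M R s'"
      using valid_s m' by (auto simp: valid_seller_strategy_def valid_messages_def s'_def)
    then have "seller_utility G M R b s' (\<beta>B h) k h \<le> seller_utility G M R b s (\<beta>B h) k h"
      using assms h by (simp add: equilibrium_def)
    moreover have "seller_menu s' = seller_menu s" "(\<lambda>h. seller_msg s' h k) = m'"
      by (simp_all add: s'_def)
    ultimately show "interim_value M even m' \<beta>B (buyer_msg b) (seller_value G \<beta>B k) r h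
      \<le> interim_value M even (\<lambda>h. seller_msg s h k) \<beta>B (buyer_msg b) (seller_value G \<beta>B k) r h"
      using seller_utility_optimal[OF h, of s' k] seller_utility_optimal[OF h, of s k] by simp
  qed (rule valid_seller_messages[OF valid_s])
  ultimately show ?thesis
    using cons valid_b valid_s
    by (simp add: talk_equilibrium_def consistent_beliefs_iff valid_buyer_messages valid_seller_messages)
qed

text \<open>Other menus or final choices never yield more than \<open>seller_value\<close> or
  \<open>buyer_terminal\<close> at a terminal history. A full deviation is therefore a deviation in
  messages with lower terminal values, to which the one-shot deviation principle applies.\<close>

lemma talk_equilibrium_imp_equilibrium:
  assumes talk: "talk_equilibrium M R (buyer_prior G) (seller_prior G) (buyer_msg b) (seller_msg s) \<beta>B \<beta>S
    (buyer_terminal G (seller_menu s) \<beta>S) (seller_value G \<beta>B)"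
  shows "equilibrium G M R b s \<beta>B \<beta>S"
proof -
  have "buyer_utility G M R b' s (\<beta>S h) i h \<le> buyer_utility G M R b s (\<beta>S h) i h"
    if h: "h \<in> histories M R" and b': "valid_buyer_strategy M R b'" for h i b'
  proof -
    have r: "length h + (R - length h) = R"
      using h by (simp add: histories_def)
    show ?thesis
      unfolding buyer_utility_optimal[OF h r refl] buyer_utility_eq_interim[OF belief_consistentI(2)[OF cons] h r, of G b']
    proof (rule one_shot_optimal_imp_le[OF _ valid_buyer_messages[OF b'] _ h r])
      show "one_shot_optimal M R odd (\<lambda>h. buyer_msg b h i) \<beta>S (seller_msg s) (buyer_terminal G (seller_menu s) \<beta>S i)"
        using talk by (simp add: talk_equilibrium_def)
      fix h assume "h \<in> histories M R" "length h = R"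
      then show "(\<Sum>k\<in>UNIV. pmf (\<beta>S h) k * (\<integral>\<mu>. (\<Sum>a\<in>UNIV. pmf (buyer_choice b' h (signal G k) \<mu> i) a *
        buyer_payoff (buyer_val G i k) \<mu> a) \<partial>seller_menu s h k)) \<le> buyer_terminal G (seller_menu s) \<beta>S i h"
        unfolding buyer_terminal_def
        by (intro sum_mono mult_left_mono integral_choice_le[OF regular b']
            valid_seller_menu[OF valid_s]) simp_all
    qed
  qed
  moreover have "seller_utility G M R b s' (\<beta>B h) k h \<le> seller_utility G M R b s (\<beta>B h) k h"
    if h: "h \<in> histories M R" and s': "valid_seller_strategy M R s'" for h k s'
  proof -
    have r: "length h + (R - length h) = R"
      using h by (simp add: histories_def)
    show ?thesis
      unfolding seller_utility_optimal[OF h r refl] seller_utility_eq_interim[OF belief_consistentI(1)[OF cons] h r, of G s']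
    proof (rule one_shot_optimal_imp_le[OF _ valid_seller_messages[OF s'] _ h r])
      show "one_shot_optimal M R even (\<lambda>h. seller_msg s h k) \<beta>B (buyer_msg b) (seller_value G \<beta>B k)"
        using talk by (simp add: talk_equilibrium_def)
      fix h assume "h \<in> histories M R" "length h = R"
      then show "seller_terminal G b s' \<beta>B k h \<le> seller_value G \<beta>B k h"
        by (intro seller_terminal_le[OF regular valid_b optimal] valid_seller_menu[OF s'])
    qed
  qed
  ultimately show ?thesis
    using valid_b valid_s cons optimal by (simp add: equilibrium_def)
qed

end

end

text \<open>The seller's optimality is required after every history, also one of probability zero.
  So her menu stage is worth \<open>seller_value\<close> at all terminal histories, as the reduction
  to the talk phase presupposes.\<close>

lemma equilibriumD:
  fixes G :: "('n::finite, 'l::finite, 'g::finite, 's) talk_game"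
  assumes regular: "regular_game G" and eq: "equilibrium G M R b s \<beta>B \<beta>S"
  shows "talk_equilibrium M R (buyer_prior G) (seller_prior G) (buyer_msg b) (seller_msg s) \<beta>B \<beta>S
      (buyer_terminal G (seller_menu s) \<beta>S) (seller_value G \<beta>B)" (is ?A)
    and "ex_ante_utilities G M R b s = talk_utilities M R (buyer_prior G) (seller_prior G)
      (buyer_msg b) (seller_msg s) \<beta>B \<beta>S (buyer_terminal G (seller_menu s) \<beta>S) (seller_value G \<beta>B)" (is ?B)
    and "h \<in> histories M R \<Longrightarrow> length h = R \<Longrightarrow>
      AE \<mu> in seller_menu s h k. \<mu> \<in> space menu_space \<and>
        (\<Sum>i\<in>UNIV. pmf (\<beta>B h) i * seller_max (buyer_val G i k) (cost G k) \<mu>) = seller_value G \<beta>B k h"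
proof -
  have *: "valid_buyer_strategy M R b" "valid_seller_strategy M R s"
    "consistent_beliefs G M R b s \<beta>B \<beta>S" "optimal_choices G M R b"
    using eq by (simp_all add: equilibrium_def)
  have terminal: "seller_terminal G b s \<beta>B k h = seller_value G \<beta>B k h"
    if "h \<in> histories M R" "length h = R" for h k
    using eq that *(3)
    by (intro seller_terminal_eq_opt[OF regular *(1,4) _ *(2)])
      (auto simp: equilibrium_def consistent_beliefs_iff)
  show ?A
    by (rule equilibrium_imp_talk_equilibrium[OF regular * terminal eq])
  show ?B
    by (rule ex_ante_utilities_eq[OF regular * terminal])
  show "AE \<mu> in seller_menu s h k. \<mu> \<in> space menu_space \<and>
      (\<Sum>i\<in>UNIV. pmf (\<beta>B h) i * seller_max (buyer_val G i k) (cost G k) \<mu>) = seller_value G \<beta>B k h"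
    if h: "h \<in> histories M R" "length h = R"
    using *(2) h
    by (intro AE_optimal_menu[OF regular *(1,4) h] terminal) (auto simp: valid_seller_strategy_def)
qed

section \<open>Changing the terminal payoffs of the talk phase\<close>

lemma one_shot_optimal_cong:
  assumes "\<And>h. h \<in> histories M R \<Longrightarrow> length h = R \<Longrightarrow> g h = g' h"
  shows "one_shot_optimal M R own m \<beta> \<sigma> g \<longleftrightarrow> one_shot_optimal M R own m \<beta> \<sigma> g'"
proof -
  have "interim_value M own m \<beta> \<sigma> g r h = interim_value M own m \<beta> \<sigma> g' r h"
    if "h \<in> histories M R" "length h + r = R" for h r
    using assms that by (intro walk_cong[of M R]) auto
  then show ?thesis
    by (simp add: one_shot_optimal_def histories_append)
qed

lemma talk_cong:
  assumes gB: "\<And>i h. h \<in> histories M R \<Longrightarrow> length h = R \<Longrightarrow> gB i h = gB' i h"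
    and gS: "\<And>k h. h \<in> histories M R \<Longrightarrow> length h = R \<Longrightarrow> gS k h = gS' k h"
  shows "talk_equilibrium M R \<pi>B \<pi>S mB mS \<beta>B \<beta>S gB gS \<longleftrightarrow> talk_equilibrium M R \<pi>B \<pi>S mB mS \<beta>B \<beta>S gB' gS'"
    and "talk_utilities M R \<pi>B \<pi>S mB mS \<beta>B \<beta>S gB gS = talk_utilities M R \<pi>B \<pi>S mB mS \<beta>B \<beta>S gB' gS'"
proof -
  show "talk_equilibrium M R \<pi>B \<pi>S mB mS \<beta>B \<beta>S gB gS \<longleftrightarrow> talk_equilibrium M R \<pi>B \<pi>S mB mS \<beta>B \<beta>S gB' gS'"
    unfolding talk_equilibrium_def
    using one_shot_optimal_cong[of M R "gB _" "gB' _"] one_shot_optimal_cong[of M R "gS _" "gS' _"]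
      gB gS by (intro conj_cong refl all_cong1) blast+
  have "interim_value M odd m \<beta> \<sigma> (gB i) R [] = interim_value M odd m \<beta> \<sigma> (gB' i) R []"
    for m i and \<beta> :: "nat list \<Rightarrow> 'b pmf" and \<sigma>
    using gB by (intro walk_cong[of M R]) auto
  moreover have "interim_value M even m \<beta> \<sigma> (gS k) R [] = interim_value M even m \<beta> \<sigma> (gS' k) R []"
    for m k and \<beta> :: "nat list \<Rightarrow> 'a pmf" and \<sigma>
    using gS by (intro walk_cong[of M R]) auto
  ultimately show "talk_utilities M R \<pi>B \<pi>S mB mS \<beta>B \<beta>S gB gS = talk_utilities M R \<pi>B \<pi>S mB mS \<beta>B \<beta>S gB' gS'"
    by (simp add: talk_utilities_def)
qed

text \<open>Each buyer type is treated by \<open>reoptimise_excluded\<close>, with its probability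
  under the seller's belief as \<open>p\<close>. Its messages change only where that probability is
  \<open>0\<close>, so predictions, Bayes' rule and the seller's incentives are unaffected.\<close>

lemma talk_equilibrium_lower_excluded:
  fixes \<beta>B :: "nat list \<Rightarrow> 'n::finite pmf" and \<beta>S :: "nat list \<Rightarrow> 'l::finite pmf"
  assumes M: "1 \<le> M" and talk: "talk_equilibrium M R \<pi>B \<pi>S mB mS \<beta>B \<beta>S gB gS"
    and le: "\<And>i h. h \<in> histories M R \<Longrightarrow> length h = R \<Longrightarrow> gB' i h \<le> gB i h"
    and eq: "\<And>i h. h \<in> histories M R \<Longrightarrow> length h = R \<Longrightarrow> 0 < pmf (\<beta>B h) i \<Longrightarrow> gB' i h = gB i h"
  shows "\<exists>mB'. talk_equilibrium M R \<pi>B \<pi>S mB' mS \<beta>B \<beta>S gB' gS \<and>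
    talk_utilities M R \<pi>B \<pi>S mB' mS \<beta>B \<beta>S gB' gS = talk_utilities M R \<pi>B \<pi>S mB mS \<beta>B \<beta>S gB gS"
proof -
  have valid: "valid_messages M R (\<lambda>h. mB h i)" "valid_messages M R (\<lambda>h. mS h k)"
    and root: "\<beta>B [] = \<pi>B" "\<beta>S [] = \<pi>S"
    and cons: "belief_consistent M R even \<beta>B mB" "belief_consistent M R odd \<beta>S mS"
    and opt: "one_shot_optimal M R odd (\<lambda>h. mB h i) \<beta>S mS (gB i)"
      "one_shot_optimal M R even (\<lambda>h. mS h k) \<beta>B mB (gS k)" for i k
    using talk by (simp_all add: talk_equilibrium_def)
  have "\<exists>m'. valid_messages M R m' \<and> (\<forall>h. 0 < pmf (\<beta>B h) i \<longrightarrow> m' h = mB h i) \<and>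
    one_shot_optimal M R odd m' \<beta>S mS (gB' i) \<and>
    (\<forall>h\<in>histories M R. \<forall>r. length h + r = R \<longrightarrow> 0 < pmf (\<beta>B h) i \<longrightarrow>
      interim_value M odd m' \<beta>S mS (gB' i) r h = interim_value M odd (\<lambda>h. mB h i) \<beta>S mS (gB i) r h)" for i
  proof (rule reoptimise_excluded[OF M valid(1) opt(1)])
    fix h x assume h: "h \<in> histories M R" "length h < R" and x: "x \<in> {1..M}"
    show "pmf (\<beta>B (h @ [x])) i = pmf (\<beta>B h) i" if "\<not> odd (R - length h)"
      using cons(1) h x that by (auto simp: belief_consistent_def)
    \<comment> \<open>Bayes' rule never excludes a type on account of a message that this type sends
      with positive probability.\<close>
    show "0 < pmf (\<beta>B (h @ [x])) i" if "odd (R - length h)" "0 < pmf (\<beta>B h) i" "0 < pmf (mB h i) x"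
    proof -
      have "bayes_update (\<beta>B h) (mB h) x (\<beta>B (h @ [x]))"
        using cons(1) h x that unfolding belief_consistent_def by (metis (full_types))
      moreover have "0 < predicted (\<beta>B h) (mB h) x"
        using that predicted_pos_iff by blast
      ultimately show ?thesis
        using that by (simp add: bayes_update_predicted)
    qed
  qed (use le eq in auto)
  then obtain m where m: "\<And>i. valid_messages M R (m i)" "\<And>i h. 0 < pmf (\<beta>B h) i \<Longrightarrow> m i h = mB h i"
    "\<And>i. one_shot_optimal M R odd (m i) \<beta>S mS (gB' i)"
    "\<And>i h r. h \<in> histories M R \<Longrightarrow> length h + r = R \<Longrightarrow> 0 < pmf (\<beta>B h) i \<Longrightarrow>
      interim_value M odd (m i) \<beta>S mS (gB' i) r h = interim_value M odd (\<lambda>h. mB h i) \<beta>S mS (gB i) r h"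
    by metis
  define mB' where "mB' = (\<lambda>h i. m i h)"
  have message: "pmf (\<beta>B h) i * pmf (mB' h i) x = pmf (\<beta>B h) i * pmf (mB h i) x" for h i x
    using m(2)[of h i] by (cases "0 < pmf (\<beta>B h) i") (auto simp: mB'_def less_le)
  then have pred: "predicted (\<beta>B h) (mB' h) = predicted (\<beta>B h) (mB h)" for h
    by (intro ext) (simp only: predicted_def)
  have "bayes_update (\<beta>B h) (mB' h) x \<beta>' \<longleftrightarrow> bayes_update (\<beta>B h) (mB h) x \<beta>'" for h x \<beta>'
    by (simp add: bayes_update_predicted pred message)
  then have cons': "belief_consistent M R even \<beta>B mB'"
    using cons(1) by (simp add: belief_consistent_def)
  have weight: "interim_weight even m \<beta>B mB' = interim_weight even m \<beta>B mB" for m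
    by (intro ext) (simp add: interim_weight_def pred)
  have "talk_equilibrium M R \<pi>B \<pi>S mB' mS \<beta>B \<beta>S gB' gS"
    unfolding talk_equilibrium_def
    using valid(2) root cons' cons(2) m(1,3) opt(2)
    by (simp add: one_shot_optimal_def weight) (simp add: mB'_def)
  moreover have "talk_utilities M R \<pi>B \<pi>S mB' mS \<beta>B \<beta>S gB' gS = talk_utilities M R \<pi>B \<pi>S mB mS \<beta>B \<beta>S gB gS"
  proof -
    \<comment> \<open>At the root the belief is the prior, so a type whose value may have dropped
      has ex ante weight \<open>0\<close>.\<close>
    have "pmf \<pi>B i * interim_value M odd (m i) \<beta>S mS (gB' i) R []
      = pmf \<pi>B i * interim_value M odd (\<lambda>h. mB h i) \<beta>S mS (gB i) R []" for i
      using m(4)[of "[]" R i] root by (cases "0 < pmf \<pi>B i") (auto simp: less_le)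
    then show ?thesis
      unfolding talk_utilities_def weight by (simp only: mB'_def)
  qed
  ultimately show ?thesis by blast
qed

lemma equilibrium_utilities_eq:
  "equilibrium_utilities G M R = {ex_ante_utilities G M R b s | b s \<beta>B \<beta>S. equilibrium G M R b s \<beta>B \<beta>S}"
  by (simp add: equilibrium_utilities_def ex_ante_utilities_def)

text \<open>The buyer cannot condition on the seller's type, so he breaks ties by a cost vector
  \<open>d\<close> that is a function of the signal. By \<open>profit\<close> this is as good for
  the seller as her true costs on the menus that \<omega> posts. After other menus any optimal
  choice will do, since the seller gets at most \<open>seller_value\<close> from them.\<close>

lemma talk_utilities_attained:
  fixes G :: "('n::finite, 'l::finite, 'g::finite, 's) talk_game" and d :: "'s \<Rightarrow> 'g \<Rightarrow> real"
  assumes regular: "regular_game G" and val: "\<And>i k. buyer_val G i k = v i (signal G k)"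
    and talk: "talk_equilibrium M R (buyer_prior G) (seller_prior G) mB mS \<beta>B \<beta>S
      (buyer_terminal G \<omega> \<beta>S) (seller_value G \<beta>B)"
    and \<omega>: "\<And>h k. h \<in> histories M R \<Longrightarrow> \<omega> h k \<in> space (prob_algebra menu_space)"
    and profit: "\<And>h k i. h \<in> histories M R \<Longrightarrow> length h = R \<Longrightarrow> AE \<mu> in \<omega> h k.
      (\<Sum>a\<in>UNIV. pmf (favourable_choice (buyer_val G i k) (d (signal G k)) \<mu>) a * seller_payoff (cost G k) \<mu> a)
      = seller_max (buyer_val G i k) (cost G k) \<mu>"
    and opt: "\<And>h k. h \<in> histories M R \<Longrightarrow> length h = R \<Longrightarrow> AE \<mu> in \<omega> h k.
      (\<Sum>i\<in>UNIV. pmf (\<beta>B h) i * seller_max (buyer_val G i k) (cost G k) \<mu>) = seller_value G \<beta>B k h"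
  shows "talk_utilities M R (buyer_prior G) (seller_prior G) mB mS \<beta>B \<beta>S
    (buyer_terminal G \<omega> \<beta>S) (seller_value G \<beta>B) \<in> equilibrium_utilities G M R"
proof -
  define b where "b = \<lparr>buyer_msg = mB, buyer_choice = (\<lambda>h t \<mu> i. favourable_choice (v i t) (d t) \<mu>)\<rparr>"
  define s where "s = \<lparr>seller_msg = mS, seller_menu = \<omega>\<rparr>"
  have sel [simp]: "buyer_msg b = mB" "seller_msg s = mS" "seller_menu s = \<omega>"
    "buyer_choice b h t \<mu> i = favourable_choice (v i t) (d t) \<mu>" for h t \<mu> i
    by (simp_all add: b_def s_def)
  have best: "set_pmf (favourable_choice w c \<mu>) \<subseteq> best w \<mu>" for w c and \<mu> :: "('n, 'g) menu"
    by (auto simp: set_favourable_choice)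
  have valid_b: "valid_buyer_strategy M R b"
    unfolding valid_buyer_strategy_def
    using talk best best_subset_offered measurable_favourable_choice
    by (fastforce simp: talk_equilibrium_def valid_messages_def)
  have valid_s: "valid_seller_strategy M R s"
    using talk \<omega> by (auto simp: valid_seller_strategy_def talk_equilibrium_def valid_messages_def)
  have optimal: "optimal_choices G M R b"
    unfolding optimal_choices_def
  proof (intro ballI impI allI)
    fix h :: "nat list" and \<mu> :: "('n, 'g) menu" and i k a assume "a \<in> offered \<mu>"
    then show "buyer_payoff (buyer_val G i k) \<mu> a \<le> (\<Sum>a'\<in>UNIV. pmf (buyer_choice b h (signal G k) \<mu> i) a' *
      buyer_payoff (buyer_val G i k) \<mu> a')"
      by (simp add: val sum_favourable_choice_buyer buyer_payoff_le_max)
  qed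
  have cons: "consistent_beliefs G M R b s \<beta>B \<beta>S"
    using talk by (simp add: consistent_beliefs_iff talk_equilibrium_def)
  have terminal: "seller_terminal G b s \<beta>B k h = seller_value G \<beta>B k h"
    if h: "h \<in> histories M R" "length h = R" for h k
  proof -
    interpret prob_space "\<omega> h k"
      using \<omega>[OF h(1)] by (rule prob_algebra_menu_space)
    have "AE \<mu> in \<omega> h k. \<forall>i\<in>UNIV.
      (\<Sum>a\<in>UNIV. pmf (favourable_choice (buyer_val G i k) (d (signal G k)) \<mu>) a * seller_payoff (cost G k) \<mu> a)
      = seller_max (buyer_val G i k) (cost G k) \<mu>"
      using profit[OF h] by (intro AE_finite_allI) auto
    then have "AE \<mu> in \<omega> h k. menu_profit G b (\<beta>B h) h k \<mu> = seller_value G \<beta>B k h"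
      using opt[OF h, of k]
    proof eventually_elim
      case (elim \<mu>)
      then show ?case
        by (simp add: menu_profit_def flip: val)
    qed
    moreover have "menu_profit G b (\<beta>B h) h k \<in> borel_measurable (\<omega> h k)"
      unfolding measurable_cong_sets[OF prob_algebra_menu_space(2)[OF \<omega>[OF h(1)]] refl]
      using valid_b h(1) by (rule measurable_menu_profit)
    ultimately have "(\<integral>\<mu>. menu_profit G b (\<beta>B h) h k \<mu> \<partial>\<omega> h k) = (\<integral>\<mu>. seller_value G \<beta>B k h \<partial>\<omega> h k)"
      by (intro integral_cong_AE) auto
    then show ?thesis
      using seller_terminal_eq_integral[OF regular valid_b optimal h, of s k \<beta>B] \<omega>[OF h(1)]
      by (simp add: prob_space)
  qed
  have "equilibrium G M R b s \<beta>B \<beta>S"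
    using talk
    by (intro talk_equilibrium_imp_equilibrium[OF regular valid_b valid_s cons optimal terminal]) simp_all
  moreover have "ex_ante_utilities G M R b s = talk_utilities M R (buyer_prior G) (seller_prior G) mB mS \<beta>B \<beta>S
    (buyer_terminal G \<omega> \<beta>S) (seller_value G \<beta>B)"
    using ex_ante_utilities_eq[OF regular valid_b valid_s cons optimal terminal] by simp
  ultimately show ?thesis
    unfolding equilibrium_utilities_eq by force
qed

section \<open>Menus of a single seller type\<close>

lemma sum_slice:
  fixes f :: "'g::finite \<Rightarrow> real" and w :: "'g \<times> 'l::finite \<Rightarrow> real"
  assumes "\<And>j. F (j, k) = f j" "\<And>j k'. k' \<noteq> k \<Longrightarrow> F (j, k') = 0"
  shows "(\<Sum>p\<in>UNIV. F p * w p) = (\<Sum>j\<in>UNIV. f j * w (j, k))"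
proof -
  have "(\<Sum>p\<in>UNIV. F p * w p) = (\<Sum>p\<in>(\<lambda>j. (j, k)) ` UNIV. F p * w p)"
    using assms by (intro sum.mono_neutral_right) (auto simp: image_iff)
  also have "\<dots> = (\<Sum>j\<in>UNIV. f j * w (j, k))"
    using assms by (subst sum.reindex) (auto simp: inj_on_def)
  finally show ?thesis .
qed

definition embed_menu :: "'l \<Rightarrow> ('n, 'g) menu \<Rightarrow> ('n, 'g \<times> 'l) menu" where
  "embed_menu k \<mu> = (\<lambda>i. (\<lambda>(j, k'). if k' = k then fst (\<mu> i) j else 0, snd (\<mu> i)))"

text \<open>An entry with foreign copies is withdrawn as a whole, by an infinite price, instead of
  being truncated. Hence the options that remain have their old payoffs.\<close>

definition restrict_menu :: "'l \<Rightarrow> ('n, 'g \<times> 'l) menu \<Rightarrow> ('n, 'g) menu" where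
  "restrict_menu k \<nu> = (\<lambda>i. (\<lambda>j. fst (\<nu> i) (j, k),
     if \<forall>j k'. k' \<noteq> k \<longrightarrow> fst (\<nu> i) (j, k') = 0 then snd (\<nu> i) else \<infinity>))"

lemma embed_menu_space: "\<mu> \<in> space menu_space \<Longrightarrow> embed_menu k \<mu> \<in> space menu_space"
  by (simp add: space_menu_space embed_menu_def)

lemma restrict_menu_space: "\<nu> \<in> space menu_space \<Longrightarrow> restrict_menu k \<nu> \<in> space menu_space"
  by (simp add: space_menu_space restrict_menu_def)

text \<open>Menus are functions on finite types with values in second countable spaces, so Borel
  measurability can be checked by coordinates.\<close>

lemma measurable_menuI:
  fixes f :: "'a \<Rightarrow> ('n::finite, 'g::finite) menu"
  assumes "f \<in> space N \<rightarrow> space menu_space"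
    and "\<And>i j. (\<lambda>x. fst (f x i) j) \<in> borel_measurable N" "\<And>i. (\<lambda>x. snd (f x i)) \<in> borel_measurable N"
  shows "f \<in> measurable N menu_space"
  unfolding menu_space_def
proof (rule measurable_restrict_space2)
  show "f \<in> space N \<rightarrow> {\<mu>. \<forall>i j. fst (\<mu> i) j \<in> {0..1}}"
    using assms(1) by (auto simp: Pi_iff space_menu_space)
  have "(\<lambda>x. (fst (f x i), snd (f x i))) \<in> borel_measurable N" for i
    by (intro borel_measurable_Pair measurable_coordinatewise_then_product assms)
  then show "f \<in> borel_measurable N"
    by (intro measurable_coordinatewise_then_product) simp
qed

lemma measurable_embed_menu:
  "embed_menu k \<in> measurable (menu_space :: ('n::finite, 'g::finite) menu measure)
    (menu_space :: ('n, 'g \<times> 'l::finite) menu measure)"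
proof (rule measurable_menuI)
  show "embed_menu k \<in> space (menu_space :: ('n, 'g) menu measure) \<rightarrow> space menu_space"
    by (rule Pi_I) (rule embed_menu_space)
  fix i :: 'n and p :: "'g \<times> 'l"
  show "(\<lambda>\<mu>. fst (embed_menu k \<mu> i) p) \<in> borel_measurable (menu_space :: ('n, 'g) menu measure)"
    by (cases p; cases "snd p = k") (simp_all add: embed_menu_def)
qed (simp add: embed_menu_def)

lemma measurable_restrict_menu:
  "restrict_menu k \<in> measurable (menu_space :: ('n::finite, 'g::finite \<times> 'l::finite) menu measure)
    (menu_space :: ('n, 'g) menu measure)"
proof (rule measurable_menuI)
  show "restrict_menu k \<in> space (menu_space :: ('n, 'g \<times> 'l) menu measure) \<rightarrow> space menu_space"
    by (rule Pi_I) (rule restrict_menu_space)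
  fix i :: 'n
  have "Measurable.pred (menu_space :: ('n, 'g \<times> 'l) menu measure)
    (\<lambda>\<nu>. \<forall>j k'. k' \<noteq> k \<longrightarrow> fst (\<nu> i) (j, k') = 0)"
    by measurable
  then show "(\<lambda>\<nu>. snd (restrict_menu k \<nu> i)) \<in> borel_measurable (menu_space :: ('n, 'g \<times> 'l) menu measure)"
    unfolding restrict_menu_def snd_conv
    by (intro measurable_If measurable_price borel_measurable_const) (simp add: pred_def)
qed (simp add: restrict_menu_def)

lemma offered_embed_menu [simp]: "offered (embed_menu k \<mu>) = offered \<mu>"
  by (auto simp: offered_def embed_menu_def)

lemma buyer_payoff_embed_menu [simp]:
  fixes \<mu> :: "('n, 'g::finite) menu" and w :: "'g \<times> 'l::finite \<Rightarrow> real"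
  shows "buyer_payoff w (embed_menu k \<mu>) a = buyer_payoff (\<lambda>j. w (j, k)) \<mu> a"
proof (cases a)
  case (Some i)
  have "(\<Sum>p\<in>UNIV. fst (embed_menu k \<mu> i) p * w p) = (\<Sum>j\<in>UNIV. fst (\<mu> i) j * w (j, k))"
    by (rule sum_slice) (simp_all add: embed_menu_def)
  then show ?thesis
    using Some by (simp add: embed_menu_def)
qed simp

lemma seller_payoff_embed_menu [simp]:
  fixes \<mu> :: "('n, 'g::finite) menu" and w :: "'g \<times> 'l::finite \<Rightarrow> real"
  shows "seller_payoff w (embed_menu k \<mu>) a = seller_payoff (\<lambda>j. w (j, k)) \<mu> a"
proof (cases a)
  case (Some i)
  have "(\<Sum>p\<in>UNIV. fst (embed_menu k \<mu> i) p * w p) = (\<Sum>j\<in>UNIV. fst (\<mu> i) j * w (j, k))"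
    by (rule sum_slice) (simp_all add: embed_menu_def)
  then show ?thesis
    using Some by (simp add: embed_menu_def)
qed simp

lemma best_embed_menu [simp]: "best w (embed_menu k \<mu>) = best (\<lambda>j. w (j, k)) \<mu>"
  by (simp add: best_def)

lemma buyer_max_embed_menu [simp]: "buyer_max w (embed_menu k \<mu>) = buyer_max (\<lambda>j. w (j, k)) \<mu>"
  by (simp add: buyer_max_def)

lemma seller_max_embed_menu [simp]:
  "seller_max w c (embed_menu k \<mu>) = seller_max (\<lambda>j. w (j, k)) (\<lambda>j. c (j, k)) \<mu>"
  by (simp add: seller_max_def)

lemma offered_restrict_menu:
  "a \<in> offered (restrict_menu k \<nu>) \<longleftrightarrow> a \<in> offered \<nu> \<and>
    (\<forall>i j k'. a = Some i \<longrightarrow> k' \<noteq> k \<longrightarrow> fst (\<nu> i) (j, k') = 0)"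
  by (cases a) (auto simp: restrict_menu_def)

lemma payoff_restrict_menu:
  fixes \<nu> :: "('n, 'g::finite \<times> 'l::finite) menu"
  assumes "a \<in> offered (restrict_menu k \<nu>)"
  shows "buyer_payoff (\<lambda>j. w (j, k)) (restrict_menu k \<nu>) a = buyer_payoff w \<nu> a"
    and "seller_payoff (\<lambda>j. w (j, k)) (restrict_menu k \<nu>) a = seller_payoff w \<nu> a"
proof -
  have *: "(\<Sum>p\<in>UNIV. fst (\<nu> i) p * w p) = (\<Sum>j\<in>UNIV. fst (\<nu> i) (j, k) * w (j, k))" if "a = Some i" for i
    using assms that by (intro sum_slice) (auto simp: offered_restrict_menu)
  have price: "snd (restrict_menu k \<nu> i) = snd (\<nu> i)" if "a = Some i" for i
  proof -
    have "\<forall>j k'. k' \<noteq> k \<longrightarrow> fst (\<nu> i) (j, k') = 0"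
      using assms that by (auto simp: offered_restrict_menu)
    then show ?thesis
      by (simp add: restrict_menu_def)
  qed
  show "buyer_payoff (\<lambda>j. w (j, k)) (restrict_menu k \<nu>) a = buyer_payoff w \<nu> a"
    by (cases a) (simp_all add: price *, simp add: restrict_menu_def)
  show "seller_payoff (\<lambda>j. w (j, k)) (restrict_menu k \<nu>) a = seller_payoff w \<nu> a"
    by (cases a) (simp_all add: price *, simp add: restrict_menu_def)
qed

lemma buyer_max_restrict_le:
  fixes \<nu> :: "('n::finite, 'g::finite \<times> 'l::finite) menu"
  shows "buyer_max (\<lambda>j. w (j, k)) (restrict_menu k \<nu>) \<le> buyer_max w \<nu>"
proof -
  obtain a where "a \<in> offered (restrict_menu k \<nu>)"
    "buyer_payoff (\<lambda>j. w (j, k)) (restrict_menu k \<nu>) a = buyer_max (\<lambda>j. w (j, k)) (restrict_menu k \<nu>)"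
    using buyer_max_attained by blast
  then show ?thesis
    using buyer_payoff_le_max[of a \<nu> w]
    by (simp add: payoff_restrict_menu(1)[where w = w] offered_restrict_menu)
qed

text \<open>Withdrawing options cannot raise the maximum, and the surviving option \<open>a\<close>
  still attains it.\<close>

lemma best_restrict_menu:
  fixes \<nu> :: "('n::finite, 'g::finite \<times> 'l::finite) menu"
  assumes "a \<in> best w \<nu>" "a \<in> offered (restrict_menu k \<nu>)"
  shows "a \<in> best (\<lambda>j. w (j, k)) (restrict_menu k \<nu>)"
    and "buyer_max (\<lambda>j. w (j, k)) (restrict_menu k \<nu>) = buyer_max w \<nu>"
proof -
  have "buyer_payoff (\<lambda>j. w (j, k)) (restrict_menu k \<nu>) a = buyer_max w \<nu>"
    using payoff_restrict_menu(1)[OF assms(2), of w] assms(1) by (simp add: best_iff)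
  then show "buyer_max (\<lambda>j. w (j, k)) (restrict_menu k \<nu>) = buyer_max w \<nu>"
    "a \<in> best (\<lambda>j. w (j, k)) (restrict_menu k \<nu>)"
    using buyer_max_restrict_le[of w k \<nu>] assms(2)
      buyer_payoff_le_max[OF assms(2), of "\<lambda>j. w (j, k)"] by (auto simp: best_iff)
qed

section \<open>Passing between menus and incentive-compatible profiles\<close>

definition menu_entry :: "('n, 'h) menu \<Rightarrow> 'n option \<Rightarrow> (real ^ 'h) \<times> real" where
  "menu_entry \<nu> a = (case a of None \<Rightarrow> 0 | Some i \<Rightarrow> (\<chi> j. fst (\<nu> i) j, enn2real (snd (\<nu> i))))"

lemma entry_utility_menu_entry: "entry_utility v (menu_entry \<nu> a) = buyer_payoff v \<nu> a"
  by (cases a) (simp_all add: menu_entry_def entry_utility_def mult.commute)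

lemma entry_profit_menu_entry: "entry_profit c (menu_entry \<nu> a) = seller_payoff c \<nu> a"
  by (cases a) (simp_all add: menu_entry_def entry_profit_def mult.commute)

text \<open>What another type chooses is available to type \<open>i\<close> too, which gives
  incentive compatibility; the option \<open>None\<close> gives individual rationality.\<close>

lemma ic_profile_of_menu:
  fixes v :: "'n::finite \<Rightarrow> 'h::finite \<Rightarrow> real" and \<nu> :: "('n, 'h) menu"
  assumes "\<nu> \<in> space menu_space" and a: "\<And>i. a i \<in> best (v i) \<nu>"
  shows "(\<chi> i. menu_entry \<nu> (a i)) \<in> ic_profiles v"
proof -
  have off: "a i \<in> offered \<nu>" for i
    using subsetD[OF best_subset_offered a] .
  have best: "buyer_payoff (v i) \<nu> a' \<le> buyer_payoff (v i) \<nu> (a i)" if "a' \<in> offered \<nu>" for i a'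
    using a[of i] that by (simp add: best_def)
  have "0 \<le> buyer_payoff (v i) \<nu> (a i)" for i
    using best[of None i] by simp
  moreover have "0 \<le> fst (menu_entry \<nu> a') $ j \<and> fst (menu_entry \<nu> a') $ j \<le> 1 \<and> 0 \<le> snd (menu_entry \<nu> a')"
    for a' j
    using assms(1) by (cases a') (simp_all add: menu_entry_def space_menu_space)
  ultimately show ?thesis
    unfolding ic_profiles_def mem_Collect_eq vec_lambda_beta entry_utility_menu_entry
    using best[OF off] by blast
qed

text \<open>When the profile is posted as a menu, the entry meant for type \<open>i\<close> is among
  his best options, and favourable tie-breaking can only add to its profit. Dropping the coordinates
  of foreign copies changes no payoff, as they are \<open>0\<close>.\<close>

lemma menu_of_ic_profile:
  fixes q :: "('n::finite, 'g::finite \<times> 'l::finite) profile"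
  assumes q: "q \<in> ic_profiles v" and slice: "\<And>i j k'. k' \<noteq> k \<Longrightarrow> fst (q $ i) $ (j, k') = 0"
  shows "\<exists>\<mu>\<in>space (menu_space :: ('n, 'g) menu measure).
    \<forall>i c. entry_profit c (q $ i) \<le> seller_max (\<lambda>j. v i (j, k)) (\<lambda>j. c (j, k)) \<mu>"
proof -
  define \<mu> :: "('n, 'g) menu" where "\<mu> = (\<lambda>i. (\<lambda>j. fst (q $ i) $ (j, k), ennreal (snd (q $ i))))"
  have price: "enn2real (snd (\<mu> i)) = snd (q $ i)" for i
    using q by (simp add: \<mu>_def ic_profiles_def)
  have sum: "(\<Sum>p\<in>UNIV. w p * fst (q $ i) $ p) = (\<Sum>j\<in>UNIV. fst (\<mu> i) j * w (j, k))" for i w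
    using sum_slice[of "\<lambda>p. fst (q $ i) $ p" k "\<lambda>j. fst (\<mu> i) j" w] slice
    by (simp add: \<mu>_def mult.commute)
  have "\<mu> \<in> space menu_space"
    using q by (simp add: space_menu_space \<mu>_def ic_profiles_def)
  moreover have "entry_profit c (q $ i) \<le> seller_max (\<lambda>j. v i (j, k)) (\<lambda>j. c (j, k)) \<mu>" for i c
  proof -
    have util: "buyer_payoff (\<lambda>j. v i (j, k)) \<mu> (Some i') = entry_utility (v i) (q $ i')" for i'
      by (simp add: price entry_utility_def sum)
    have "buyer_payoff (\<lambda>j. v i (j, k)) \<mu> a \<le> buyer_payoff (\<lambda>j. v i (j, k)) \<mu> (Some i)" for a
      unfolding util using q by (cases a) (simp_all only: util, simp_all add: ic_profiles_def)
    then have "Some i \<in> best (\<lambda>j. v i (j, k)) \<mu>"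
      by (simp add: best_def) (simp add: \<mu>_def)
    then have "seller_payoff (\<lambda>j. c (j, k)) \<mu> (Some i) \<le> seller_max (\<lambda>j. v i (j, k)) (\<lambda>j. c (j, k)) \<mu>"
      by (rule seller_payoff_le_max)
    moreover have "seller_payoff (\<lambda>j. c (j, k)) \<mu> (Some i) = entry_profit c (q $ i)"
      by (simp add: price entry_profit_def sum)
    ultimately show ?thesis by simp
  qed
  ultimately show ?thesis by blast
qed

context
  fixes v :: "'n::finite \<Rightarrow> 'g::finite \<times> 'l::finite \<Rightarrow> real" and c :: "'g \<times> 'l \<Rightarrow> real" and k :: 'l
  assumes v: "\<And>i p. 0 \<le> v i p" and c: "\<And>p. 0 \<le> c p"
    and improvement: "\<And>q. q \<in> ic_profiles v \<Longrightarrow>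
      \<exists>q'\<in>ic_profiles v. improves_without {p. snd p \<noteq> k} c q' q"
begin

text \<open>The favourable choices form a profile, whose improvement without foreign copies is
  turned back into a menu. For a type whose selected choice contains foreign copies the improvement
  is strict; otherwise that choice survives the restriction, which is the second
  alternative.\<close>

lemma improving_menu:
  fixes \<nu> :: "('n, 'g \<times> 'l) menu"
  assumes \<nu>: "\<nu> \<in> space menu_space"
  shows "\<exists>\<mu>\<in>space (menu_space :: ('n, 'g) menu measure). \<forall>i.
    seller_max (v i) c \<nu> \<le> seller_max (\<lambda>j. v i (j, k)) (\<lambda>j. c (j, k)) \<mu> \<and>
    (seller_max (v i) c \<nu> < seller_max (\<lambda>j. v i (j, k)) (\<lambda>j. c (j, k)) \<mu> \<or>
     (\<exists>a\<in>best (v i) \<nu>. a \<in> offered (restrict_menu k \<nu>) \<and> seller_payoff c \<nu> a = seller_max (v i) c \<nu>))"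
proof -
  have "\<exists>a. a \<in> best (v i) \<nu> \<and> seller_payoff c \<nu> a = seller_max (v i) c \<nu>" for i
    using seller_max_attained by blast
  then obtain a where a: "\<And>i. a i \<in> best (v i) \<nu>" "\<And>i. seller_payoff c \<nu> (a i) = seller_max (v i) c \<nu>"
    by metis
  define q :: "('n, 'g \<times> 'l) profile" where "q = (\<chi> i. menu_entry \<nu> (a i))"
  have "q \<in> ic_profiles v"
    unfolding q_def using \<nu> a(1) by (rule ic_profile_of_menu)
  then obtain q' where q': "q' \<in> ic_profiles v" "improves_without {p. snd p \<noteq> k} c q' q"
    using improvement by blast
  then obtain \<mu> :: "('n, 'g) menu" where \<mu>: "\<mu> \<in> space menu_space"
    "\<And>i. entry_profit c (q' $ i) \<le> seller_max (\<lambda>j. v i (j, k)) (\<lambda>j. c (j, k)) \<mu>"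
    using menu_of_ic_profile[of q' v k] by (auto simp: improves_without_def)
  have profit: "entry_profit c (q $ i) = seller_max (v i) c \<nu>" for i
    by (simp add: q_def entry_profit_menu_entry a)
  have "seller_max (v i) c \<nu> \<le> seller_max (\<lambda>j. v i (j, k)) (\<lambda>j. c (j, k)) \<mu>" for i
  proof -
    have "entry_profit c (q $ i) \<le> entry_profit c (q' $ i)"
      using q'(2) by (simp add: improves_without_def)
    then show ?thesis
      using \<mu>(2)[of i] profit[of i] by simp
  qed
  moreover have "seller_max (v i) c \<nu> < seller_max (\<lambda>j. v i (j, k)) (\<lambda>j. c (j, k)) \<mu>"
    if foreign: "a i \<notin> offered (restrict_menu k \<nu>)" for i
  proof -
    have "a i \<in> offered \<nu>"
      using a(1) best_subset_offered by blast
    then obtain i' j k' where "a i = Some i'" "k' \<noteq> k" "fst (\<nu> i') (j, k') \<noteq> 0"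
      using foreign by (auto simp: offered_restrict_menu)
    then have "\<exists>p\<in>{p. snd p \<noteq> k}. fst (q $ i) $ p \<noteq> 0"
      by (intro bexI[of _ "(j, k')"]) (simp_all add: q_def menu_entry_def)
    then have "entry_profit c (q $ i) < entry_profit c (q' $ i)"
      using q'(2) unfolding improves_without_def by blast
    then show ?thesis
      using \<mu>(2)[of i] profit[of i] by simp
  qed
  moreover have "(\<exists>a\<in>best (v i) \<nu>. a \<in> offered (restrict_menu k \<nu>) \<and> seller_payoff c \<nu> a = seller_max (v i) c \<nu>)"
    if "a i \<in> offered (restrict_menu k \<nu>)" for i
    using a that by (intro bexI[of _ "a i"] conjI)
  ultimately show ?thesis
    by (intro bexI[OF _ \<mu>(1)] allI conjI) blast+
qed

text \<open>\<open>improving_menu\<close> gives one inequality, \<open>embed_menu\<close> the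
  other.\<close>

lemma seller_opt_slice: "seller_opt v c \<beta> = seller_opt (\<lambda>i j. v i (j, k)) (\<lambda>j. c (j, k)) \<beta>"
proof (rule antisym)
  show "seller_opt v c \<beta> \<le> seller_opt (\<lambda>i j. v i (j, k)) (\<lambda>j. c (j, k)) \<beta>"
  proof (rule seller_opt_least)
    fix \<nu> :: "('n, 'g \<times> 'l) menu" assume "\<nu> \<in> space menu_space"
    then obtain \<mu> :: "('n, 'g) menu" where \<mu>: "\<mu> \<in> space menu_space"
      "\<And>i. seller_max (v i) c \<nu> \<le> seller_max (\<lambda>j. v i (j, k)) (\<lambda>j. c (j, k)) \<mu>"
      using improving_menu by blast
    then have "(\<Sum>i\<in>UNIV. pmf \<beta> i * seller_max (v i) c \<nu>)
        \<le> (\<Sum>i\<in>UNIV. pmf \<beta> i * seller_max (\<lambda>j. v i (j, k)) (\<lambda>j. c (j, k)) \<mu>)"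
      by (intro sum_mono mult_left_mono) auto
    also have "\<dots> \<le> seller_opt (\<lambda>i j. v i (j, k)) (\<lambda>j. c (j, k)) \<beta>"
      using v c \<mu> by (intro seller_opt_upper) auto
    finally show "(\<Sum>i\<in>UNIV. pmf \<beta> i * seller_max (v i) c \<nu>)
        \<le> seller_opt (\<lambda>i j. v i (j, k)) (\<lambda>j. c (j, k)) \<beta>" .
  qed
  show "seller_opt (\<lambda>i j. v i (j, k)) (\<lambda>j. c (j, k)) \<beta> \<le> seller_opt v c \<beta>"
  proof (rule seller_opt_least)
    fix \<mu> :: "('n, 'g) menu" assume "\<mu> \<in> space menu_space"
    then show "(\<Sum>i\<in>UNIV. pmf \<beta> i * seller_max (\<lambda>j. v i (j, k)) (\<lambda>j. c (j, k)) \<mu>) \<le> seller_opt v c \<beta>"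
      using seller_opt_upper[of v c "embed_menu k \<mu>" \<beta>] v c by (simp add: embed_menu_space)
  qed
qed

context
  fixes \<nu> :: "('n, 'g \<times> 'l) menu" and \<beta> :: "'n pmf"
  assumes \<nu>: "\<nu> \<in> space menu_space"
    and optimal: "(\<Sum>i\<in>UNIV. pmf \<beta> i * seller_max (v i) c \<nu>) = seller_opt v c \<beta>"
begin

text \<open>Otherwise the improving menu would be strictly better than an optimal one.\<close>

lemma optimal_menu_entry:
  assumes "0 < pmf \<beta> i"
  shows "\<exists>a\<in>best (v i) \<nu>. a \<in> offered (restrict_menu k \<nu>) \<and> seller_payoff c \<nu> a = seller_max (v i) c \<nu>"
proof (rule ccontr)
  assume none: "\<not> ?thesis"
  obtain \<mu> :: "('n, 'g) menu" where \<mu>: "\<mu> \<in> space menu_space"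
    "\<And>i. seller_max (v i) c \<nu> \<le> seller_max (\<lambda>j. v i (j, k)) (\<lambda>j. c (j, k)) \<mu>"
    "seller_max (v i) c \<nu> < seller_max (\<lambda>j. v i (j, k)) (\<lambda>j. c (j, k)) \<mu>"
    using improving_menu[OF \<nu>] none by blast
  have "(\<Sum>i\<in>UNIV. pmf \<beta> i * seller_max (v i) c \<nu>)
      < (\<Sum>i\<in>UNIV. pmf \<beta> i * seller_max (\<lambda>j. v i (j, k)) (\<lambda>j. c (j, k)) \<mu>)"
    using \<mu>(2,3) assms
    by (intro sum_strict_mono_ex1) (auto intro!: mult_left_mono mult_strict_left_mono exI[of _ i])
  also have "\<dots> \<le> seller_opt (\<lambda>i j. v i (j, k)) (\<lambda>j. c (j, k)) \<beta>"
    using v c \<mu>(1) by (intro seller_opt_upper) auto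
  finally show False
    using optimal by (simp add: seller_opt_slice)
qed

lemma buyer_max_restrict_menu:
  "0 < pmf \<beta> i \<Longrightarrow> buyer_max (\<lambda>j. v i (j, k)) (restrict_menu k \<nu>) = buyer_max (v i) \<nu>"
  using optimal_menu_entry best_restrict_menu(2) by blast

text \<open>Types with positive probability retain a favourable choice, and the others carry no
  weight. So the expected profit does not fall below the optimum, which is the same for both sets of
  goods.\<close>

lemma seller_max_restrict_menu:
  "(\<Sum>i\<in>UNIV. pmf \<beta> i * seller_max (\<lambda>j. v i (j, k)) (\<lambda>j. c (j, k)) (restrict_menu k \<nu>))
    = seller_opt (\<lambda>i j. v i (j, k)) (\<lambda>j. c (j, k)) \<beta>"
proof (rule antisym)
  show "(\<Sum>i\<in>UNIV. pmf \<beta> i * seller_max (\<lambda>j. v i (j, k)) (\<lambda>j. c (j, k)) (restrict_menu k \<nu>))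
    \<le> seller_opt (\<lambda>i j. v i (j, k)) (\<lambda>j. c (j, k)) \<beta>"
    using v c \<nu> by (intro seller_opt_upper restrict_menu_space) auto
  have "pmf \<beta> i * seller_max (v i) c \<nu>
    \<le> pmf \<beta> i * seller_max (\<lambda>j. v i (j, k)) (\<lambda>j. c (j, k)) (restrict_menu k \<nu>)" for i
  proof (cases "0 < pmf \<beta> i")
    case True
    then obtain a where a: "a \<in> best (v i) \<nu>" "a \<in> offered (restrict_menu k \<nu>)"
      "seller_payoff c \<nu> a = seller_max (v i) c \<nu>"
      using optimal_menu_entry by blast
    then have "seller_max (v i) c \<nu> \<le> seller_max (\<lambda>j. v i (j, k)) (\<lambda>j. c (j, k)) (restrict_menu k \<nu>)"
      using seller_payoff_le_max[OF best_restrict_menu(1)[OF a(1,2)], of "\<lambda>j. c (j, k)"]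
      by (simp add: payoff_restrict_menu(2)[where w = c])
    then show ?thesis
      by (intro mult_left_mono) auto
  qed (simp add: less_le)
  then show "seller_opt (\<lambda>i j. v i (j, k)) (\<lambda>j. c (j, k)) \<beta>
    \<le> (\<Sum>i\<in>UNIV. pmf \<beta> i * seller_max (\<lambda>j. v i (j, k)) (\<lambda>j. c (j, k)) (restrict_menu k \<nu>))"
    unfolding seller_opt_slice[symmetric] optimal[symmetric] by (intro sum_mono)
qed

end

end

section \<open>The replicated instance\<close>

definition replicated_instance ::
    "real \<Rightarrow> ('n, 'l, 'g) interdep_data \<Rightarrow> ('n, 'l, 'g \<times> 'l) indep_data" where
  "replicated_instance H I = \<lparr>buyer_prior = buyer_prior I, seller_prior = seller_prior I,
     cost = (\<lambda>k (j, k'). if k' = k then cost I k j else H),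
     indep_val = (\<lambda>i (j, k'). interdep_val I i k' j)\<rparr>"

lemma game_simps [simp]:
  "buyer_prior (interdep_game I) = buyer_prior I" "seller_prior (interdep_game I) = seller_prior I"
  "cost (interdep_game I) = cost I" "buyer_val (interdep_game I) = interdep_val I"
  "signal (interdep_game I) k = k"
  by (simp_all add: interdep_game_def)

lemma replicated_game_simps [simp]:
  "buyer_prior (indep_game (replicated_instance H I)) = buyer_prior I"
  "seller_prior (indep_game (replicated_instance H I)) = seller_prior I"
  "cost (indep_game (replicated_instance H I)) k (j, k') = (if k' = k then cost I k j else H)"
  "buyer_val (indep_game (replicated_instance H I)) i k (j, k') = interdep_val I i k' j"
  by (simp_all add: indep_game_def replicated_instance_def)

lemma replicated_game_val:
  "buyer_val (indep_game (replicated_instance H I)) i k = (\<lambda>(j, k'). interdep_val I i k' j)"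
  by (simp add: indep_game_def replicated_instance_def)

context
  fixes I :: "('n::finite, 'l::finite, 'g::finite) interdep_data" and H :: real and M R :: nat
  assumes I: "interdep_values_instance I" and H_nonneg: "0 \<le> H"
    and improvement: "\<And>k q. q \<in> ic_profiles (\<lambda>i (j, k'). interdep_val I i k' j) \<Longrightarrow>
      \<exists>q'\<in>ic_profiles (\<lambda>i (j, k'). interdep_val I i k' j).
        improves_without {p. snd p \<noteq> k} (cost (indep_game (replicated_instance H I)) k) q' q"
    and M: "1 \<le> M"
begin

abbreviation (input) "original \<equiv> interdep_game I"
abbreviation (input) "replicated \<equiv> indep_game (replicated_instance H I)"

lemma regular_original: "regular_game original"
  using I by (simp add: regular_game_def interdep_values_instance_def)

lemma regular_replicated: "regular_game replicated"
  using I H_nonneg by (simp add: regular_game_def interdep_values_instance_def split_paired_all)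

lemma nonneg_replicated: "0 \<le> buyer_val replicated i k p" "0 \<le> cost replicated k p"
  using regular_replicated by (rule buyer_val_nonneg, rule cost_nonneg)

lemma improvement_replicated: "q \<in> ic_profiles (\<lambda>i. buyer_val replicated i k) \<Longrightarrow>
    \<exists>q'\<in>ic_profiles (\<lambda>i. buyer_val replicated i k). improves_without {p. snd p \<noteq> k} (cost replicated k) q' q"
  unfolding replicated_game_val by (rule improvement)

text \<open>As this holds for every belief, the seller's terminal payoffs agree in the two talk
  phases.\<close>

lemma seller_value_eq: "seller_value replicated \<beta>B k h = seller_value original \<beta>B k h"
  using seller_opt_slice[of "\<lambda>i. buyer_val replicated i k" "cost replicated k" k, OF nonneg_replicated improvement_replicated] by simp

text \<open>Embedding the posted menus changes no terminal payoff, so messages and beliefs can be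
  kept.\<close>

lemma equilibrium_utilities_subset: "equilibrium_utilities original M R \<subseteq> equilibrium_utilities replicated M R"
proof
  fix u assume "u \<in> equilibrium_utilities original M R"
  then obtain b s \<beta>B \<beta>S where eq: "equilibrium original M R b s \<beta>B \<beta>S" and u: "u = ex_ante_utilities original M R b s"
    unfolding equilibrium_utilities_eq by blast
  note D = equilibriumD[OF regular_original eq]
  define \<omega> where "\<omega> h k = distr (seller_menu s h k) menu_space (embed_menu k)" for h k
  have menu: "seller_menu s h k \<in> space (prob_algebra menu_space)" if "h \<in> histories M R" for h k
    using eq that by (auto simp: equilibrium_def valid_seller_strategy_def)
  have embed: "embed_menu k \<in> measurable (seller_menu s h k) (menu_space :: ('n, 'g \<times> 'l) menu measure)"
    if "h \<in> histories M R" for h k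
    using measurable_embed_menu prob_algebra_menu_space(2)[OF menu[OF that]] measurable_cong_sets by blast
  have buyer: "buyer_terminal replicated \<omega> \<beta>S i h = buyer_terminal original (seller_menu s) \<beta>S i h"
    if "h \<in> histories M R" for i h
    unfolding buyer_terminal_def \<omega>_def
    by (subst integral_distr[OF embed[OF that] measurable_buyer_max]) simp
  \<comment> \<open>The buyer does not observe the seller's type. He breaks ties as if each copy
    cost what it costs its own seller, which on a menu embedded for type \<open>k\<close> gives the
    true profit of \<open>k\<close>.\<close>
  define d :: "unit \<Rightarrow> 'g \<times> 'l \<Rightarrow> real" where "d t = (\<lambda>(j, k). cost I k j)" for t
  have "talk_utilities M R (buyer_prior replicated) (seller_prior replicated) (buyer_msg b) (seller_msg s) \<beta>B \<beta>S
    (buyer_terminal replicated \<omega> \<beta>S) (seller_value replicated \<beta>B) \<in> equilibrium_utilities replicated M R"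
  proof (rule talk_utilities_attained[OF regular_replicated, where d = d and v = "\<lambda>i t (j, k'). interdep_val I i k' j"])
    show "talk_equilibrium M R (buyer_prior replicated) (seller_prior replicated) (buyer_msg b) (seller_msg s) \<beta>B \<beta>S
      (buyer_terminal replicated \<omega> \<beta>S) (seller_value replicated \<beta>B)"
      using D(1) talk_cong(1)[of M R "buyer_terminal replicated \<omega> \<beta>S" "buyer_terminal original (seller_menu s) \<beta>S"
        "seller_value replicated \<beta>B" "seller_value original \<beta>B"] by (simp add: buyer seller_value_eq)
    fix h k assume h: "h \<in> histories M R"
    show "\<omega> h k \<in> space (prob_algebra menu_space)"
      unfolding \<omega>_def space_prob_algebra
      using prob_space.prob_space_distr[OF prob_algebra_menu_space(1)[OF menu[OF h]] embed[OF h]] by simp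
    assume len: "length h = R"
    show "AE \<nu> in \<omega> h k. (\<Sum>a\<in>UNIV. pmf (favourable_choice (buyer_val replicated i k) (d (signal replicated k)) \<nu>) a *
      seller_payoff (cost replicated k) \<nu> a) = seller_max (buyer_val replicated i k) (cost replicated k) \<nu>" for i
    proof -
      have "(\<Sum>a\<in>UNIV. pmf (favourable_choice (buyer_val replicated i k) (d (signal replicated k)) (embed_menu k \<mu>)) a *
        seller_payoff (cost replicated k) (embed_menu k \<mu>) a) = seller_max (buyer_val replicated i k) (cost replicated k) (embed_menu k \<mu>)"
        for \<mu> :: "('n, 'g) menu"
        by (rule sum_pmf_mult_eq) (simp add: set_favourable_choice d_def)
      then show ?thesis
        unfolding \<omega>_def by (subst AE_distr_iff[OF embed[OF h]]) simp_all
    qed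
    show "AE \<nu> in \<omega> h k. (\<Sum>i\<in>UNIV. pmf (\<beta>B h) i * seller_max (buyer_val replicated i k) (cost replicated k) \<nu>)
      = seller_value replicated \<beta>B k h"
      unfolding \<omega>_def using D(3)[OF h len, of k]
      by (subst AE_distr_iff[OF embed[OF h]]) (auto simp: seller_value_eq)
  qed (simp add: replicated_game_val)
  moreover have "talk_utilities M R (buyer_prior replicated) (seller_prior replicated) (buyer_msg b) (seller_msg s) \<beta>B \<beta>S
    (buyer_terminal replicated \<omega> \<beta>S) (seller_value replicated \<beta>B) = u"
    using D(2) talk_cong(2)[of M R "buyer_terminal replicated \<omega> \<beta>S" "buyer_terminal original (seller_menu s) \<beta>S"
        "seller_value replicated \<beta>B" "seller_value original \<beta>B"] by (simp add: u buyer seller_value_eq)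
  ultimately show "u \<in> equilibrium_utilities replicated M R"
    by simp
qed

text \<open>Restricting the posted menus may lower the payoffs of buyer types that the seller's
  belief excludes, so the buyer's messages have to be repaired by
  \<open>talk_equilibrium_lower_excluded\<close>.\<close>

lemma equilibrium_utilities_supset: "equilibrium_utilities replicated M R \<subseteq> equilibrium_utilities original M R"
proof
  fix u assume "u \<in> equilibrium_utilities replicated M R"
  then obtain b s \<beta>B \<beta>S where eq: "equilibrium replicated M R b s \<beta>B \<beta>S" and u: "u = ex_ante_utilities replicated M R b s"
    unfolding equilibrium_utilities_eq by blast
  note D = equilibriumD[OF regular_replicated eq]
  define \<omega> where "\<omega> h k = distr (seller_menu s h k) menu_space (restrict_menu k)" for h k
  have menu: "seller_menu s h k \<in> space (prob_algebra menu_space)" if "h \<in> histories M R" for h k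
    using eq that by (auto simp: equilibrium_def valid_seller_strategy_def)
  have restrict: "restrict_menu k \<in> measurable (seller_menu s h k) (menu_space :: ('n, 'g) menu measure)"
    if "h \<in> histories M R" for h k
    using measurable_restrict_menu prob_algebra_menu_space(2)[OF menu[OF that]] measurable_cong_sets by blast
  have \<omega>: "\<omega> h k \<in> space (prob_algebra menu_space)" if "h \<in> histories M R" for h k
    unfolding \<omega>_def space_prob_algebra
    using prob_space.prob_space_distr[OF prob_algebra_menu_space(1)[OF menu[OF that]] restrict[OF that]] by simp
  \<comment> \<open>Menus posted in equilibrium are almost surely optimal for the current belief, so
    the results on restricting optimal menus apply to them.\<close>
  have optimal_menu: "AE \<nu> in seller_menu s h k.
    (\<forall>i. 0 < pmf (\<beta>B h) i \<longrightarrow> buyer_max (interdep_val I i k) (restrict_menu k \<nu>) = buyer_max (buyer_val replicated i k) \<nu>) \<and>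
    (\<Sum>i\<in>UNIV. pmf (\<beta>B h) i * seller_max (interdep_val I i k) (cost I k) (restrict_menu k \<nu>)) = seller_value original \<beta>B k h"
    if h: "h \<in> histories M R" "length h = R" for h k
    using D(3)[OF h, of k]
  proof eventually_elim
    case (elim \<nu>)
    note * = nonneg_replicated improvement_replicated conjunct1[OF elim] conjunct2[OF elim]
    show ?case
      using buyer_max_restrict_menu[of "\<lambda>i. buyer_val replicated i k" "cost replicated k" k, OF *]
        seller_max_restrict_menu[of "\<lambda>i. buyer_val replicated i k" "cost replicated k" k, OF *]
      by simp
  qed
  have integrable: "integrable (seller_menu s h k) (buyer_max (buyer_val replicated i k))"
    "integrable (seller_menu s h k) (\<lambda>\<nu>. buyer_max (interdep_val I i k) (restrict_menu k \<nu>))"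
    if h: "h \<in> histories M R" for h k i
  proof -
    have "integrable (\<omega> h k) (buyer_max (buyer_val original i k))"
      by (intro integrable_buyer_max \<omega> h buyer_val_nonneg regular_original)
    then show "integrable (seller_menu s h k) (\<lambda>\<nu>. buyer_max (interdep_val I i k) (restrict_menu k \<nu>))"
      unfolding \<omega>_def by (simp add: integrable_distr_eq[OF restrict[OF h]])
    show "integrable (seller_menu s h k) (buyer_max (buyer_val replicated i k))"
      by (intro integrable_buyer_max menu h buyer_val_nonneg regular_replicated)
  qed
  have terminal: "buyer_terminal original \<omega> \<beta>S i h = (\<Sum>k\<in>UNIV. pmf (\<beta>S h) k *
      (\<integral>\<nu>. buyer_max (interdep_val I i k) (restrict_menu k \<nu>) \<partial>seller_menu s h k))"
    if "h \<in> histories M R" for i h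
    unfolding buyer_terminal_def \<omega>_def
    by (subst integral_distr[OF restrict[OF that] measurable_buyer_max]) simp
  have le: "buyer_terminal original \<omega> \<beta>S i h \<le> buyer_terminal replicated (seller_menu s) \<beta>S i h"
    if h: "h \<in> histories M R" "length h = R" for i h
  proof -
    have "(\<integral>\<nu>. buyer_max (interdep_val I i k) (restrict_menu k \<nu>) \<partial>seller_menu s h k)
      \<le> (\<integral>\<nu>. buyer_max (buyer_val replicated i k) \<nu> \<partial>seller_menu s h k)" for k
      using buyer_max_restrict_le[of "buyer_val replicated i k" k]
      by (intro integral_mono integrable h) simp
    then show ?thesis
      by (simp only: terminal[OF h(1)])
        (simp add: buyer_terminal_def[of replicated] sum_mono mult_left_mono)
  qed
  have le_eq: "buyer_terminal original \<omega> \<beta>S i h = buyer_terminal replicated (seller_menu s) \<beta>S i h"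
    if h: "h \<in> histories M R" "length h = R" and "0 < pmf (\<beta>B h) i" for i h
  proof -
    have "(\<integral>\<nu>. buyer_max (interdep_val I i k) (restrict_menu k \<nu>) \<partial>seller_menu s h k)
      = (\<integral>\<nu>. buyer_max (buyer_val replicated i k) \<nu> \<partial>seller_menu s h k)" for k
      using optimal_menu[OF h, of k] that integrable[OF h(1)]
      by (intro integral_cong_AE) (auto intro: borel_measurable_integrable)
    then show ?thesis
      by (simp only: terminal[OF h(1)]) (simp only: buyer_terminal_def)
  qed
  have "\<exists>mB'. talk_equilibrium M R (buyer_prior replicated) (seller_prior replicated) mB' (seller_msg s) \<beta>B \<beta>S
      (buyer_terminal original \<omega> \<beta>S) (seller_value replicated \<beta>B) \<and>
    talk_utilities M R (buyer_prior replicated) (seller_prior replicated) mB' (seller_msg s) \<beta>B \<beta>S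
      (buyer_terminal original \<omega> \<beta>S) (seller_value replicated \<beta>B) = u"
    unfolding u D(2) by (rule talk_equilibrium_lower_excluded[OF M D(1) le le_eq])
  then obtain mB' where talk: "talk_equilibrium M R (buyer_prior replicated) (seller_prior replicated) mB' (seller_msg s) \<beta>B \<beta>S
      (buyer_terminal original \<omega> \<beta>S) (seller_value replicated \<beta>B)"
    and util: "talk_utilities M R (buyer_prior replicated) (seller_prior replicated) mB' (seller_msg s) \<beta>B \<beta>S
      (buyer_terminal original \<omega> \<beta>S) (seller_value replicated \<beta>B) = u"
    by (elim exE conjE)
  have "talk_utilities M R (buyer_prior original) (seller_prior original) mB' (seller_msg s) \<beta>B \<beta>S
    (buyer_terminal original \<omega> \<beta>S) (seller_value original \<beta>B) \<in> equilibrium_utilities original M R"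
  proof (rule talk_utilities_attained[OF regular_original, where d = "cost I" and v = "interdep_val I"])
    show "talk_equilibrium M R (buyer_prior original) (seller_prior original) mB' (seller_msg s) \<beta>B \<beta>S
      (buyer_terminal original \<omega> \<beta>S) (seller_value original \<beta>B)"
      using talk by (simp add: seller_value_eq)
    fix h k assume h: "h \<in> histories M R"
    show "\<omega> h k \<in> space (prob_algebra menu_space)"
      using h by (rule \<omega>)
    assume len: "length h = R"
    show "AE \<mu> in \<omega> h k. (\<Sum>i\<in>UNIV. pmf (\<beta>B h) i * seller_max (buyer_val original i k) (cost original k) \<mu>)
      = seller_value original \<beta>B k h"
      unfolding \<omega>_def using optimal_menu[OF h len, of k]
      by (subst AE_distr_iff[OF restrict[OF h]]) auto
  qed (simp_all add: sum_favourable_choice_seller)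
  then show "u \<in> equilibrium_utilities original M R"
    using util by (simp add: seller_value_eq)
qed

end

text \<open>The bound \<open>C\<close> for seller type \<open>k\<close> is her total cost of the
  original goods, which does not involve \<open>H\<close>; hence there is no circularity in choosing
  \<open>H\<close> afterwards.\<close>

lemma sufficient_foreign_cost:
  fixes I :: "('n::finite, 'l::finite, 'g::finite) interdep_data"
  assumes I: "interdep_values_instance I"
  shows "\<exists>H\<ge>0. \<forall>k. \<forall>q\<in>ic_profiles (\<lambda>i (j, k'). interdep_val I i k' j).
    \<exists>q'\<in>ic_profiles (\<lambda>i (j, k'). interdep_val I i k' j).
      improves_without {p. snd p \<noteq> k} (cost (indep_game (replicated_instance H I)) k) q' q"
proof -
  let ?v = "\<lambda>i (j, k'). interdep_val I i k' j"
  have v: "0 \<le> ?v i p" for i p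
    using I by (simp add: interdep_values_instance_def split: prod.split)
  have "\<exists>H. \<forall>c. (\<forall>p. 0 \<le> c p) \<longrightarrow> (\<forall>p\<in>{p. snd p \<noteq> k}. H \<le> c p) \<longrightarrow>
      (\<Sum>p\<in>-{p. snd p \<noteq> k}. c p) \<le> (\<Sum>j\<in>UNIV. cost I k j) \<longrightarrow>
      (\<forall>q\<in>ic_profiles ?v. \<exists>q'\<in>ic_profiles ?v. improves_without {p. snd p \<noteq> k} c q' q)" for k
    by (rule ic_profile_improvement) (rule v)
  then obtain H where H: "\<And>k c. (\<forall>p. 0 \<le> c p) \<Longrightarrow> (\<forall>p\<in>{p. snd p \<noteq> k}. H k \<le> c p) \<Longrightarrow>
      (\<Sum>p\<in>-{p. snd p \<noteq> k}. c p) \<le> (\<Sum>j\<in>UNIV. cost I k j) \<Longrightarrow>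
      (\<forall>q\<in>ic_profiles ?v. \<exists>q'\<in>ic_profiles ?v. improves_without {p. snd p \<noteq> k} c q' q)"
    by metis
  \<comment> \<open>The sum of absolute values is nonnegative and exceeds no less than each of the
    finitely many thresholds, so one foreign cost serves all seller types.\<close>
  define H0 where "H0 = (\<Sum>k\<in>UNIV. \<bar>H k\<bar>)"
  have "0 \<le> H0"
    by (simp add: H0_def sum_nonneg)
  have H0: "H k \<le> H0" for k
    using member_le_sum[of k UNIV "\<lambda>k. \<bar>H k\<bar>"] by (simp add: H0_def)
  let ?c = "cost (indep_game (replicated_instance H0 I))"
  have "\<forall>q\<in>ic_profiles ?v. \<exists>q'\<in>ic_profiles ?v. improves_without {p. snd p \<noteq> k} (?c k) q' q" for k
  proof (rule H)
    show "\<forall>p. 0 \<le> ?c k p"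
      using I \<open>0 \<le> H0\<close> by (simp add: interdep_values_instance_def split_paired_all)
    show "\<forall>p\<in>{p. snd p \<noteq> k}. H k \<le> ?c k p"
      using H0 by auto
    have "-{p. snd p \<noteq> k} = (\<lambda>j. (j, k)) ` (UNIV :: 'g set)"
      by auto
    then show "(\<Sum>p\<in>-{p. snd p \<noteq> k}. ?c k p) \<le> (\<Sum>j\<in>UNIV. cost I k j)"
      by (simp add: sum.reindex inj_on_def)
  qed
  then show ?thesis
    using \<open>0 \<le> H0\<close> by blast
qed

theorem proposition6p1:
  fixes I :: "('n::finite, 'l::finite, 'g::finite) interdep_data"
  assumes "interdep_values_instance I"
  shows "\<exists>J :: ('n, 'l, 'g \<times> 'l) indep_data. indep_values_instance J \<and>
    (\<forall>M R. M \<ge> 1 \<longrightarrow>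
       equilibrium_utilities (indep_game J) M R = equilibrium_utilities (interdep_game I) M R)"
proof -
  obtain H where H: "0 \<le> H" "\<And>k q. q \<in> ic_profiles (\<lambda>i (j, k'). interdep_val I i k' j) \<Longrightarrow>
    \<exists>q'\<in>ic_profiles (\<lambda>i (j, k'). interdep_val I i k' j).
      improves_without {p. snd p \<noteq> k} (cost (indep_game (replicated_instance H I)) k) q' q"
    using sufficient_foreign_cost[OF assms] by blast
  have "indep_values_instance (replicated_instance H I)"
    using assms H(1)
    by (simp add: indep_values_instance_def interdep_values_instance_def replicated_instance_def)
  moreover have "equilibrium_utilities (indep_game (replicated_instance H I)) M R
      = equilibrium_utilities (interdep_game I) M R" if "1 \<le> M" for M R
    using equilibrium_utilities_subset[OF assms H that] equilibrium_utilities_supset[OF assms H that]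
    by (rule subset_antisym[rotated])
  ultimately show ?thesis by blast
qed

end
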